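(* There exist a compact $2$-convex Riemannian $3$-manifold $\mathbf{M}$ and a Jordan curve $\gamma$ in $\partial\mathbf{M}$, with $\gamma$ nullhomotopic in $\mathbf{M}$, such that for $H\in(1,2)$ there exists no minimizing $H$-disk $\Sigma_H$ in $\mathbf{M}$ with $\partial\Sigma_H=\gamma$.
   Context: **$H_0$-convex (here $H_0=2$).** A compact Riemannian $3$-manifold $M$ with piecewise smooth boundary is $H_0$-convex if (i) along the smooth parts of $\partial M$ the mean curvature vector $\mathbf{H}$ points towards the inside of $M$; (ii) $|\mathbf{H}(p)|\ge H_0$ at every smooth point $p\in\partial M$; (iii) along the nonsmooth parts of $\partial M$ the inner dihedral angle is less than $\pi$. Mean curvature is normalized so that a ball of radius $R$ in $\mathbb{R}^3$ is $\frac1R$-convex. **Immersed disks.** Let $D^2$ be the unit disk. An immersed disk in $M$ with boundary $\gamma$ is $u(D^2)$ for an immersion $u:D^2\to M$ with $u\in C^0(\overline{D^2})\cap C^2(D^2)$ such that $u|_{\partial D^2}$ is an embedding onto $\gamma$. It is an $H$-disk if it has constant mean curvature $H$ at every point. **Minimizing $H$-disks.** An immersed $H$-disk is a minimizing $H$-disk if it attains the absolute minimum of the functional $\mathcal{F}_H$ among the immersed disks with the same boundary. In a domain of $\mathbb{R}^3$, $$\mathcal{F}_H(u)=\int_{D^2}|u_x|^2+|u_y|^2+\tfrac43 H\,[u\cdot(u_x\times u_y)]\,dx\,dy .$$ In a Riemannian $3$-manifold $M$ with boundary, the last term is read as $4H\int_{D^2}u^*\omega$, where $\omega$ is a fixed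 $2$-form whose exterior derivative is the volume form of $M$ (in $\mathbb{R}^3$ one takes $\omega$ with $\int u^*\omega=\frac13\int u\cdot(u_x\times u_y)$). For conformal $u$, the first part is twice the area; so, up to an additive constant and a factor $2$, $\mathcal{F}_H$ is then area plus $2H$ times the oriented volume enclosed between the disk and a fixed reference surface with boundary $\gamma$, whenever these bound a region. *)

theory Defs
  imports "HOL-Analysis.Analysis"
begin

section \<open>Calculus in coordinates\<close>

(* C^k maps; only used on open sets S, where differentiable_on is differentiability at each point. *)
primrec Ck_on ::
  "nat \<Rightarrow> ('a::euclidean_space \<Rightarrow> 'b::real_normed_vector) \<Rightarrow> 'a set \<Rightarrow> bool" where
  "Ck_on 0 f S = continuous_on S f"
| "Ck_on (Suc k) f S =
     (f differentiable_on S \<and> (\<forall>v. Ck_on k (\<lambda>x. frechet_derivative f (at x) v) S))"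

definition smooth_on ::
  "('a::euclidean_space \<Rightarrow> 'b::real_normed_vector) \<Rightarrow> 'a set \<Rightarrow> bool" where
  "smooth_on f S \<longleftrightarrow> (\<forall>k. Ck_on k f S)"

definition partial ::
  "'n::finite \<Rightarrow> (real^'n \<Rightarrow> 'b::real_normed_vector) \<Rightarrow> real^'n \<Rightarrow> 'b" where
  "partial i f x = frechet_derivative f (at x) (axis i 1)"

definition jacobian :: "(real^'n \<Rightarrow> real^'m) \<Rightarrow> real^'n \<Rightarrow> real^'n^'m" where
  "jacobian f x = matrix (frechet_derivative f (at x))"

(* The bilinear form with coefficient matrix A; used for metrics and for 2-forms. *)
definition bil :: "real^'n^'n \<Rightarrow> real^'n \<Rightarrow> real^'n \<Rightarrow> real" where
  "bil A v w = v \<bullet> (A *v w)"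

section \<open>Oriented Riemannian 3-manifolds\<close>

type_synonym 'a chart = "'a set \<times> ('a \<Rightarrow> real^3)"

(* coordinate expressions of a (0,2)-tensor field: chart, coordinate point, coefficient matrix *)
type_synonym 'a tensor2 = "'a chart \<Rightarrow> real^3 \<Rightarrow> real^3^3"

record 'a riem =
  Top :: "'a topology"
  Atlas :: "'a chart set"
  Metric :: "'a tensor2"

definition transition :: "'a chart \<Rightarrow> 'a chart \<Rightarrow> real^3 \<Rightarrow> real^3" where
  "transition c d = snd d \<circ> inv_into (fst c) (snd c)"

definition smooth_tensor2 :: "'a riem \<Rightarrow> 'a tensor2 \<Rightarrow> bool" where
  "smooth_tensor2 N T \<longleftrightarrow>
     (\<forall>c\<in>Atlas N. smooth_on (T c) (snd c ` fst c)) \<and>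
     (\<forall>c\<in>Atlas N. \<forall>d\<in>Atlas N. \<forall>x\<in>snd c ` (fst c \<inter> fst d).
        T c x = transpose (jacobian (transition c d) x) ** T d (transition c d x)
                  ** jacobian (transition c d) x)"

(* Manifolds without boundary. The orientation (needed for the volume form) is carried
   by the atlas. *)
definition riemannian_3_manifold :: "'a riem \<Rightarrow> bool" where
  "riemannian_3_manifold N \<longleftrightarrow>
     Hausdorff_space (Top N) \<and> second_countable (Top N) \<and>
     (\<Union>c\<in>Atlas N. fst c) = topspace (Top N) \<and>
     (\<forall>c\<in>Atlas N. openin (Top N) (fst c) \<and> open (snd c ` fst c) \<and>
        homeomorphic_map (subtopology (Top N) (fst c)) (top_of_set (snd c ` fst c)) (snd c)) \<and>
     (\<forall>c\<in>Atlas N. \<forall>d\<in>Atlas N.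
        smooth_on (transition c d) (snd c ` (fst c \<inter> fst d)) \<and>
        (\<forall>x\<in>snd c ` (fst c \<inter> fst d). det (jacobian (transition c d) x) > 0)) \<and>
     smooth_tensor2 N (Metric N) \<and>
     (\<forall>c\<in>Atlas N. \<forall>x\<in>snd c ` fst c.
        transpose (Metric N c x) = Metric N c x \<and>
        (\<forall>v. v \<noteq> 0 \<longrightarrow> bil (Metric N c x) v v > 0))"

definition gnorm :: "real^3^3 \<Rightarrow> real^3 \<Rightarrow> real" where
  "gnorm A v = sqrt (bil A v v)"

(* Only used for quantities that do not depend on the chart. *)
definition chart_at :: "'a riem \<Rightarrow> 'a \<Rightarrow> 'a chart" where
  "chart_at N p = (SOME c. c \<in> Atlas N \<and> p \<in> fst c)"

section \<open>Mean curvature vector of an immersed surface\<close>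

(* christoffel g x v w has k-th component Gamma^k_ij v^i w^j. *)
definition christoffel ::
  "(real^3 \<Rightarrow> real^3^3) \<Rightarrow> real^3 \<Rightarrow> real^3 \<Rightarrow> real^3 \<Rightarrow> real^3" where
  "christoffel g x v w = (\<chi> k. \<Sum>i\<in>UNIV. \<Sum>j\<in>UNIV. \<Sum>l\<in>UNIV.
     (1/2) * (matrix_inv (g x) $ k $ l) *
       (partial i g x $ j $ l + partial j g x $ i $ l - partial l g x $ i $ j) * (v $ i) * (w $ j))"

definition first_form :: "(real^3 \<Rightarrow> real^3^3) \<Rightarrow> (real^2 \<Rightarrow> real^3) \<Rightarrow> real^2 \<Rightarrow> real^2^2" where
  "first_form g F z = (\<chi> i j. bil (g (F z)) (partial i F z) (partial j F z))"

definition normal_part ::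
  "(real^3 \<Rightarrow> real^3^3) \<Rightarrow> (real^2 \<Rightarrow> real^3) \<Rightarrow> real^2 \<Rightarrow> real^3 \<Rightarrow> real^3" where
  "normal_part g F z v = v - (\<Sum>i\<in>UNIV. \<Sum>j\<in>UNIV.
     (matrix_inv (first_form g F z) $ i $ j * bil (g (F z)) v (partial i F z)) *\<^sub>R partial j F z)"

definition second_form ::
  "(real^3 \<Rightarrow> real^3^3) \<Rightarrow> (real^2 \<Rightarrow> real^3) \<Rightarrow> real^2 \<Rightarrow> 2 \<Rightarrow> 2 \<Rightarrow> real^3" where
  "second_form g F z i j = normal_part g F z
     (partial i (partial j F) z + christoffel g (F z) (partial i F z) (partial j F z))"

(* Half the trace: a sphere of radius R in flat space has mean curvature 1/R. *)
definition mean_curvature_vector ::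
  "(real^3 \<Rightarrow> real^3^3) \<Rightarrow> (real^2 \<Rightarrow> real^3) \<Rightarrow> real^2 \<Rightarrow> real^3" where
  "mean_curvature_vector g F z = (1/2) *\<^sub>R (\<Sum>i\<in>UNIV. \<Sum>j\<in>UNIV.
     (matrix_inv (first_form g F z) $ i $ j) *\<^sub>R second_form g F z i j)"

section \<open>Compact domains with piecewise smooth boundary\<close>

text \<open>A compact Riemannian 3-manifold with piecewise smooth boundary is a compact subset M, with
  piecewise smooth frontier, of a Riemannian 3-manifold N without boundary.\<close>

abbreviation bdry :: "'a riem \<Rightarrow> 'a set \<Rightarrow> 'a set" where
  "bdry N M \<equiv> Top N frontier_of M"

(* In the chart c, the set M agrees with S on the neighbourhood V of p. *)
definition local_shape ::
  "'a riem \<Rightarrow> 'a set \<Rightarrow> 'a \<Rightarrow> 'a chart \<Rightarrow> (real^3) set \<Rightarrow> (real^3) set \<Rightarrow> bool" where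
  "local_shape N M p c V S \<longleftrightarrow>
     c \<in> Atlas N \<and> p \<in> fst c \<and> open V \<and> snd c p \<in> V \<and> V \<subseteq> snd c ` fst c \<and>
     snd c ` (M \<inter> fst c) \<inter> V = S \<inter> V"

(* f = 0 is a smooth surface in V passing through x. *)
definition regular_equation :: "(real^3 \<Rightarrow> real) \<Rightarrow> (real^3) set \<Rightarrow> real^3 \<Rightarrow> bool" where
  "regular_equation f V x \<longleftrightarrow>
     smooth_on f V \<and> f x = 0 \<and> (\<forall>y\<in>V. frechet_derivative f (at y) \<noteq> (\<lambda>_. 0))"

definition smooth_point :: "'a riem \<Rightarrow> 'a set \<Rightarrow> 'a \<Rightarrow> bool" where
  "smooth_point N M p \<longleftrightarrow>
     (\<exists>c V f. regular_equation f V (snd c p) \<and> local_shape N M p c V {x. f x \<le> 0})"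

(* Two smooth faces meeting transversally; the union covers inner dihedral angles above pi. *)
definition edge_point :: "'a riem \<Rightarrow> 'a set \<Rightarrow> 'a \<Rightarrow> bool" where
  "edge_point N M p \<longleftrightarrow>
     (\<exists>c V f1 f2. regular_equation f1 V (snd c p) \<and> regular_equation f2 V (snd c p) \<and>
        (\<forall>y\<in>V. \<forall>a b. (\<forall>v. a * frechet_derivative f1 (at y) v + b * frechet_derivative f2 (at y) v = 0)
                   \<longrightarrow> a = 0 \<and> b = 0) \<and>
        (local_shape N M p c V {x. f1 x \<le> 0 \<and> f2 x \<le> 0} \<or>
         local_shape N M p c V {x. f1 x \<le> 0 \<or> f2 x \<le> 0}))"

(* M is a topological manifold with boundary at p and is locally a finite union of finite
   intersections of smooth half-domains. *)
definition vertex_point :: "'a riem \<Rightarrow> 'a set \<Rightarrow> 'a \<Rightarrow> bool" where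
  "vertex_point N M p \<longleftrightarrow>
     (\<exists>c V \<A>. finite \<A> \<and> (\<forall>A\<in>\<A>. finite A \<and> (\<forall>f\<in>A. regular_equation f V (snd c p))) \<and>
        local_shape N M p c V (\<Union>A\<in>\<A>. {x. \<forall>f\<in>A. f x \<le> 0})) \<and>
     (\<exists>W. openin (subtopology (Top N) M) W \<and> p \<in> W \<and>
        subtopology (Top N) W homeomorphic_space top_of_set {x::real^3. 0 \<le> x $ 1})"

definition compact_domain :: "'a riem \<Rightarrow> 'a set \<Rightarrow> bool" where
  "compact_domain N M \<longleftrightarrow>
     riemannian_3_manifold N \<and> M \<noteq> {} \<and> compactin (Top N) M \<and>
     (\<forall>p\<in>bdry N M. smooth_point N M p \<or> edge_point N M p \<or> vertex_point N M p) \<and>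
     finite {p \<in> bdry N M. \<not> smooth_point N M p \<and> \<not> edge_point N M p}"

(* One-sided tangent vectors of S at x, as limits of difference quotients. *)
definition tangent_cone :: "(real^3) set \<Rightarrow> real^3 \<Rightarrow> (real^3) set" where
  "tangent_cone S x = {v. \<exists>y t. (\<forall>n. y n \<in> S \<and> (t n :: real) > 0) \<and> t \<longlonglongrightarrow> 0 \<and>
     (\<lambda>n. (1 / t n) *\<^sub>R (y n - x)) \<longlonglongrightarrow> v}"

(* The tangent cone of M at p is a wedge of opening angle \<theta>, measured by the metric. *)
definition has_dihedral_angle :: "'a riem \<Rightarrow> 'a set \<Rightarrow> 'a \<Rightarrow> real \<Rightarrow> bool" where
  "has_dihedral_angle N M p \<theta> \<longleftrightarrow> 0 < \<theta> \<and> \<theta> < 2 * pi \<and>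
     (\<exists>c\<in>Atlas N. p \<in> fst c \<and> (\<exists>e :: 3 \<Rightarrow> real^3.
        (\<forall>i j. bil (Metric N c (snd c p)) (e i) (e j) = (if i = j then 1 else 0)) \<and>
        tangent_cone (snd c ` (M \<inter> fst c)) (snd c p) =
          {s *\<^sub>R e 3 + r *\<^sub>R (cos t *\<^sub>R e 1 + sin t *\<^sub>R e 2) | s r t. 0 \<le> r \<and> 0 \<le> t \<and> t \<le> \<theta>}))"

(* h is the mean curvature vector of the boundary at p, in the chart c. *)
definition boundary_mean_curvature ::
  "'a riem \<Rightarrow> 'a set \<Rightarrow> 'a \<Rightarrow> 'a chart \<Rightarrow> real^3 \<Rightarrow> bool" where
  "boundary_mean_curvature N M p c h \<longleftrightarrow>
     (\<exists>W \<psi> z. open W \<and> z \<in> W \<and> smooth_on \<psi> W \<and> (\<forall>w\<in>W. inj (frechet_derivative \<psi> (at w))) \<and>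
        \<psi> z = snd c p \<and> \<psi> ` W \<subseteq> snd c ` (bdry N M \<inter> fst c) \<and>
        h = mean_curvature_vector (Metric N c) \<psi> z)"

(* Meaningful for vectors transverse to the boundary. *)
definition points_inside :: "'a riem \<Rightarrow> 'a set \<Rightarrow> 'a \<Rightarrow> 'a chart \<Rightarrow> real^3 \<Rightarrow> bool" where
  "points_inside N M p c v \<longleftrightarrow>
     (\<exists>\<epsilon>>0. \<forall>t\<in>{0<..<\<epsilon>}. snd c p + t *\<^sub>R v \<in> snd c ` (Top N interior_of M \<inter> fst c))"

definition H0_convex :: "real \<Rightarrow> 'a riem \<Rightarrow> 'a set \<Rightarrow> bool" where
  "H0_convex H0 N M \<longleftrightarrow>
     compact_domain N M \<and>
     (\<forall>p\<in>bdry N M. smooth_point N M p \<longrightarrow>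
        (\<exists>c\<in>Atlas N. p \<in> fst c \<and> (\<exists>h. boundary_mean_curvature N M p c h \<and>
           points_inside N M p c h \<and> gnorm (Metric N c (snd c p)) h \<ge> H0))) \<and>
     (\<forall>p\<in>bdry N M. edge_point N M p \<longrightarrow> (\<exists>\<theta><pi. has_dihedral_angle N M p \<theta>))"

section \<open>Jordan curves and immersed disks\<close>

abbreviation circle :: "(real^2) topology" where
  "circle \<equiv> top_of_set (sphere 0 1)"

(* A Jordan curve is the image of an embedding of the unit circle. *)
definition jordan_curve_in :: "'a topology \<Rightarrow> 'a set \<Rightarrow> bool" where
  "jordan_curve_in X \<Gamma> \<longleftrightarrow>
     (\<exists>\<gamma>. embedding_map circle X \<gamma> \<and> \<gamma> ` sphere 0 1 = \<Gamma>)"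

definition nullhomotopic_curve_in :: "'a topology \<Rightarrow> 'a set \<Rightarrow> bool" where
  "nullhomotopic_curve_in X \<Gamma> \<longleftrightarrow>
     (\<exists>\<gamma>. embedding_map circle X \<gamma> \<and> \<gamma> ` sphere 0 1 = \<Gamma> \<and>
        (\<exists>a. homotopic_with (\<lambda>_. True) circle X \<gamma> (\<lambda>_. a)))"

definition immersed_disk :: "'a riem \<Rightarrow> 'a set \<Rightarrow> 'a set \<Rightarrow> (real^2 \<Rightarrow> 'a) \<Rightarrow> bool" where
  "immersed_disk N M \<Gamma> u \<longleftrightarrow>
     continuous_map (top_of_set (cball 0 1)) (subtopology (Top N) M) u \<and>
     (\<forall>c\<in>Atlas N. Ck_on 2 (snd c \<circ> u) (ball 0 1 \<inter> u -` fst c) \<and>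
        (\<forall>z\<in>ball 0 1 \<inter> u -` fst c. inj (frechet_derivative (snd c \<circ> u) (at z)))) \<and>
     embedding_map circle (Top N) u \<and> u ` sphere 0 1 = \<Gamma>"

(* The mean curvature vector has length H; for H > 0 this singles out the unit normal with
   respect to which the scalar mean curvature is H. *)
definition H_disk :: "'a riem \<Rightarrow> 'a set \<Rightarrow> 'a set \<Rightarrow> real \<Rightarrow> (real^2 \<Rightarrow> 'a) \<Rightarrow> bool" where
  "H_disk N M \<Gamma> H u \<longleftrightarrow>
     immersed_disk N M \<Gamma> u \<and>
     (\<forall>z\<in>ball 0 1. \<forall>c\<in>Atlas N. u z \<in> fst c \<longrightarrow>
        gnorm (Metric N c (snd c (u z))) (mean_curvature_vector (Metric N c) (snd c \<circ> u) z) = H)"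

section \<open>The functional and its minimizers\<close>

(* A smooth 2-form with coefficients A i j = \<omega>(e_i, e_j) whose exterior derivative on M is the
   Riemannian volume form; in a chart, d\<omega> = (d_1 A_23 + d_2 A_31 + d_3 A_12) dx1 dx2 dx3. *)
definition volume_primitive :: "'a riem \<Rightarrow> 'a set \<Rightarrow> 'a tensor2 \<Rightarrow> bool" where
  "volume_primitive N M \<omega> \<longleftrightarrow>
     smooth_tensor2 N \<omega> \<and>
     (\<forall>c\<in>Atlas N. \<forall>x\<in>snd c ` fst c. transpose (\<omega> c x) = - \<omega> c x) \<and>
     (\<forall>c\<in>Atlas N. \<forall>x\<in>snd c ` (M \<inter> fst c).
        partial 1 (\<omega> c) x $ 2 $ 3 + partial 2 (\<omega> c) x $ 3 $ 1 + partial 3 (\<omega> c) x $ 1 $ 2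
          = sqrt (det (Metric N c x)))"

definition energy_density :: "'a riem \<Rightarrow> (real^2 \<Rightarrow> 'a) \<Rightarrow> real^2 \<Rightarrow> real" where
  "energy_density N u z =
     (let c = chart_at N (u z); F = snd c \<circ> u; A = Metric N c (F z)
      in bil A (partial 1 F z) (partial 1 F z) + bil A (partial 2 F z) (partial 2 F z))"

definition pullback_density :: "'a riem \<Rightarrow> 'a tensor2 \<Rightarrow> (real^2 \<Rightarrow> 'a) \<Rightarrow> real^2 \<Rightarrow> real" where
  "pullback_density N \<omega> u z =
     (let c = chart_at N (u z); F = snd c \<circ> u
      in bil (\<omega> c (F z)) (partial 1 F z) (partial 2 F z))"

(* The energy may be infinite, and then so is the functional. If it is finite, the 2-form term is
   absolutely integrable, because u takes values in a compact set. *)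
definition F_H :: "'a riem \<Rightarrow> 'a tensor2 \<Rightarrow> real \<Rightarrow> (real^2 \<Rightarrow> 'a) \<Rightarrow> ereal" where
  "F_H N \<omega> H u =
     enn2ereal (\<integral>\<^sup>+z\<in>ball 0 1. ennreal (energy_density N u z) \<partial>lborel) +
     ereal (4 * H * (LINT z:ball 0 1|lborel. pullback_density N \<omega> u z))"

definition minimizing_H_disk ::
  "'a riem \<Rightarrow> 'a set \<Rightarrow> 'a tensor2 \<Rightarrow> real \<Rightarrow> 'a set \<Rightarrow> 'a set \<Rightarrow> bool" where
  "minimizing_H_disk N M \<omega> H \<Gamma> \<Sigma> \<longleftrightarrow>
     (\<exists>u. \<Sigma> = u ` ball 0 1 \<and> H_disk N M \<Gamma> H u \<and>
        (\<forall>v. immersed_disk N M \<Gamma> v \<longrightarrow> F_H N \<omega> H u \<le> F_H N \<omega> H v))"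

end

theory Submission
  imports Defs
begin

text \<open>The functional is unbounded below, so it has no minimizers at all. The manifold is the closed
  unit ball with a conformally flat metric that is very large away from the boundary sphere but has
  zero derivative on it, so that the mean curvature of the sphere is that of a round sphere of radius 1/2.
  Around the axis of rotation consider the torus of revolution over the circle of radius 1/3 about
  (2/3, 0); it touches the boundary sphere along the equator. In the metric, the energy of the
  torus is far less than 4 times the volume inside. The disks start with a cap across the axis and
  then wrap \<open>n\<close> times around the torus, ending at the equator. In polar coordinates the parametrization
  is periodic, so every turn adds the same amount to the functional, and by Stokes' theorem on the
  solid torus this amount is negative, whichever primitive of the volume form is used.\<close>

section \<open>Calculus of \<open>C\<^sup>k\<close> maps\<close>

text \<open>2-convexity constrains the metric only along the sphere, while deep inside lengths can
  be made as large as desired; there a closed surface encloses volume far exceeding its area. The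
  obstacle is that a competitor must be an immersed disk spanning a curve on the sphere, not a
  closed surface. Hence the torus passes through the equator: a disk that sweeps over it a whole
  number of times ends on the same curve, and an immersion may overlap itself. The winding angle is
  logarithmic, because (ln |w|, arg w) are conformal coordinates and the Dirichlet energy is
  conformally invariant in dimension 2; the turns then occupy similar annuli and cost equal energy.
  Increasing angle induces the inward normal, so each turn adds minus the enclosed volume. Changing
  the primitive alters only the contribution of the cap, which is the same for all \<open>n\<close>.
  A minimizer is excluded by values alone: \<open>F_H\<close> of any map is at least its own finite
  2-form term.\<close>

lemma Ck_on_cong:
  assumes "open S" "\<And>x. x \<in> S \<Longrightarrow> f x = g x" "Ck_on k f S"
  shows "Ck_on k g S"
  using assms(2,3)
proof (induction k arbitrary: f g)
  case 0
  then show ?case by (simp cong: continuous_on_cong)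
next
  case (Suc k)
  have d: "f differentiable (at x)" if "x \<in> S" for x
    using Suc.prems(2) that \<open>open S\<close> by (simp add: differentiable_on_eq_differentiable_at)
  have "g differentiable_on S"
    unfolding differentiable_on_eq_differentiable_at[OF \<open>open S\<close>]
    using d Suc.prems(1) \<open>open S\<close>
    by (metis differentiable_def has_derivative_transform_within_open)
  moreover have "Ck_on k (\<lambda>x. frechet_derivative g (at x) v) S" for v
  proof (rule Suc.IH)
    show "frechet_derivative f (at x) v = frechet_derivative g (at x) v" if "x \<in> S" for x
      using frechet_derivative_transform_within_open[OF d[OF that] \<open>open S\<close> that] Suc.prems(1) by metis
    show "Ck_on k (\<lambda>x. frechet_derivative f (at x) v) S" using Suc.prems(2) by simp
  qed
  ultimately show ?case by simp
qed

text \<open>Regularity is read off from an explicit derivative \<open>f'\<close>, so that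
  computations need not go through the choice made by \<open>frechet_derivative\<close>.\<close>

lemma Ck_on_SucI:
  assumes "open S" and "\<And>x. x \<in> S \<Longrightarrow> (f has_derivative f' x) (at x)"
    and "\<And>v. Ck_on k (\<lambda>x. f' x v) S"
  shows "Ck_on (Suc k) f S"
proof -
  have "f differentiable_on S"
    using assms(2) by (meson differentiable_at_imp_differentiable_on differentiable_def)
  moreover have "Ck_on k (\<lambda>x. frechet_derivative f (at x) v) S" for v
    by (rule Ck_on_cong[OF assms(1) _ assms(3)[of v]]) (metis assms(2) frechet_derivative_at)
  ultimately show ?thesis by simp
qed

lemma Ck_on_Suc_has_derivative:
  assumes "open S" "Ck_on (Suc k) f S" "x \<in> S"
  shows "(f has_derivative frechet_derivative f (at x)) (at x)"
  using assms by (simp add: differentiable_on_eq_differentiable_at frechet_derivative_works)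

lemma Ck_on_SucD:
  assumes "open S" "Ck_on (Suc k) f S"
  shows "Ck_on k f S"
  using assms(2)
proof (induction k arbitrary: f)
  case 0
  then show ?case by (simp add: differentiable_imp_continuous_on)
next
  case (Suc k)
  then show ?case by auto
qed

lemma Ck_on_const [simp]: "open S \<Longrightarrow> Ck_on k (\<lambda>x. c) S"
proof (induction k arbitrary: c)
  case (Suc k)
  then show ?case by (intro Ck_on_SucI[where f'="\<lambda>_ _. 0"]) auto
qed simp

lemma Ck_on_linear:
  assumes "open S" "bounded_linear f"
  shows "Ck_on k f S"
proof (cases k)
  case 0
  then show ?thesis using assms by (simp add: linear_continuous_on)
next
  case (Suc m)
  show ?thesis unfolding Suc
    by (rule Ck_on_SucI[where f'="\<lambda>_. f"])
      (use assms in \<open>auto intro: bounded_linear_imp_has_derivative\<close>)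
qed

lemma Ck_on_add:
  assumes "open S" "Ck_on k f S" "Ck_on k g S"
  shows "Ck_on k (\<lambda>x. f x + g x) S"
  using assms(2,3)
proof (induction k arbitrary: f g)
  case 0
  then show ?case by (simp add: continuous_on_add)
next
  case (Suc k)
  note h = Ck_on_Suc_has_derivative[OF assms(1)]
  show ?case
    by (rule Ck_on_SucI[where f'="\<lambda>x v. frechet_derivative f (at x) v + frechet_derivative g (at x) v"])
      (use assms(1) Suc.prems in \<open>auto intro: has_derivative_add h Suc.IH simp del: Ck_on.simps(2)\<close>, use Suc in simp)
qed

lemma (in bounded_bilinear) Ck_on_prod:
  assumes "open S" "Ck_on k f S" "Ck_on k g S"
  shows "Ck_on k (\<lambda>x. prod (f x) (g x)) S"
  using assms(2,3)
proof (induction k arbitrary: f g)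
  case 0
  then show ?case by (simp add: continuous_on)
next
  case (Suc k)
  note h = Ck_on_Suc_has_derivative[OF assms(1)]
  show ?case
  proof (rule Ck_on_SucI[OF assms(1)])
    show "((\<lambda>x. prod (f x) (g x)) has_derivative
        (\<lambda>v. prod (f x) (frechet_derivative g (at x) v) + prod (frechet_derivative f (at x) v) (g x))) (at x)"
      if "x \<in> S" for x
      by (rule FDERIV) (use h Suc.prems that in blast)+
    show "Ck_on k (\<lambda>x. prod (f x) (frechet_derivative g (at x) v)
        + prod (frechet_derivative f (at x) v) (g x)) S" for v
    proof -
      have "Ck_on k f S" "Ck_on k g S"
        using Suc.prems by (auto intro: Ck_on_SucD[OF assms(1)] simp del: Ck_on.simps)
      then show ?thesis
        using Suc.prems by (intro Ck_on_add assms(1) Suc.IH) auto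
    qed
  qed
qed

lemmas Ck_on_scaleR = bounded_bilinear.Ck_on_prod[OF bounded_bilinear_scaleR]
lemmas Ck_on_mult = bounded_bilinear.Ck_on_prod[OF bounded_bilinear_mult]
lemmas Ck_on_inner = bounded_bilinear.Ck_on_prod[OF bounded_bilinear_inner]

lemma Ck_on_id: "open S \<Longrightarrow> Ck_on k (\<lambda>x. x) S"
  by (simp add: Ck_on_linear bounded_linear_ident)

lemma Ck_on_diff:
  assumes "open S" "Ck_on k f S" "Ck_on k g S"
  shows "Ck_on k (\<lambda>x. f x - g x) S"
  using Ck_on_add[OF assms(1,2) Ck_on_scaleR[OF assms(1) Ck_on_const[OF assms(1), of k "-1"] assms(3)]]
  by simp

lemma Ck_on_power:
  fixes f :: "'a::euclidean_space \<Rightarrow> real"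
  assumes "open S" "Ck_on k f S"
  shows "Ck_on k (\<lambda>x. f x ^ n) S"
  by (induction n) (use assms in \<open>auto intro: Ck_on_mult\<close>)

text \<open>The outer function comes with the sequence \<open>G\<close> of its derivatives. One
  chain rule step turns \<open>G 0\<close> into \<open>G 1\<close>, and the induction goes on with
  the shifted sequence.\<close>

lemma Ck_on_compose_real:
  fixes f :: "'a::euclidean_space \<Rightarrow> real" and G :: "nat \<Rightarrow> real \<Rightarrow> real"
  assumes "open S" "Ck_on k f S"
    and "\<And>n y. n < k \<Longrightarrow> (G n has_real_derivative G (Suc n) y) (at y)"
    and "continuous_on UNIV (G k)"
  shows "Ck_on k (\<lambda>x. G 0 (f x)) S"
  using assms(2-4)
proof (induction k arbitrary: G)
  case 0
  then show ?case by (auto intro: continuous_on_compose2)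
next
  case (Suc k)
  have f: "(f has_derivative frechet_derivative f (at x)) (at x)" if "x \<in> S" for x
    using Ck_on_Suc_has_derivative[OF assms(1) Suc.prems(1) that] .
  show ?case
  proof (rule Ck_on_SucI[OF assms(1)])
    show "((\<lambda>x. G 0 (f x)) has_derivative (\<lambda>v. frechet_derivative f (at x) v * G 1 (f x))) (at x)"
      if "x \<in> S" for x
      using DERIV_compose_FDERIV[OF Suc.prems(2)[of 0] f[OF that]] by simp
    have "Ck_on k (\<lambda>x. G (Suc 0) (f x)) S"
      by (rule Suc.IH[of "\<lambda>n. G (Suc n)"])
        (use Ck_on_SucD[OF assms(1) Suc.prems(1)] Suc.prems(2,3) in auto)
    then show "Ck_on k (\<lambda>x. frechet_derivative f (at x) v * G 1 (f x)) S" for v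
      using Suc.prems(1) by (intro Ck_on_mult assms(1)) auto
  qed
qed

lemma Ck_on_sin:
  fixes f :: "'a::euclidean_space \<Rightarrow> real"
  assumes "open S" "Ck_on k f S"
  shows "Ck_on k (\<lambda>x. sin (f x)) S"
proof -
  \<comment> \<open>Differentiating the sine shifts its argument by a quarter period, which gives
    all derivatives by one formula.\<close>
  have "((\<lambda>y. sin (y + real n * (pi/2))) has_real_derivative sin (y + real (Suc n) * (pi/2))) (at y)" for n y
  proof -
    have e: "y + real (Suc n) * (pi/2) = pi/2 + (y + real n * (pi/2))"
      by (simp add: field_simps)
    have "sin (y + real (Suc n) * (pi/2)) = cos (y + real n * (pi/2))"
      unfolding e sin_add by simp
    moreover have "((\<lambda>y. sin (y + real n * (pi/2))) has_real_derivative cos (y + real n * (pi/2))) (at y)"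
      by (auto intro!: derivative_eq_intros)
    ultimately show ?thesis by simp
  qed
  from Ck_on_compose_real[OF assms, where G="\<lambda>n y. sin (y + real n * (pi/2))", OF this]
  show ?thesis by (simp add: continuous_intros)
qed

lemma Ck_on_cos:
  fixes f :: "'a::euclidean_space \<Rightarrow> real"
  assumes "open S" "Ck_on k f S"
  shows "Ck_on k (\<lambda>x. cos (f x)) S"
proof -
  have "Ck_on k (\<lambda>x. sin (pi/2 - f x)) S"
    by (intro Ck_on_sin Ck_on_diff Ck_on_const assms)
  then show ?thesis by (simp add: cos_sin_eq)
qed

lemmas Ck_on_intros = Ck_on_const Ck_on_id Ck_on_add Ck_on_diff Ck_on_scaleR Ck_on_mult Ck_on_inner
  Ck_on_power Ck_on_sin Ck_on_cos

section \<open>The conformally flat ball\<close>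

text \<open>The factor \<open>(1 - |x|\<^sup>2)\<^sup>2\<close> has zero derivative on the unit sphere, so the Christoffel symbols
  vanish there. The constant \<open>10^6\<close> only has to be large enough for the volume inside the torus
  of revolution (cubic in it) to outweigh the energy of the torus (quadratic in it).\<close>

definition conf :: "real^3 \<Rightarrow> real" where
  "conf x = 1/2 + 10^6 * (1 - x \<bullet> x)^2"

definition ball_chart :: "(real^3) chart" where "ball_chart = (UNIV, \<lambda>x. x)"

definition ball_metric :: "(real^3) tensor2" where "ball_metric c x = (conf x)^2 *\<^sub>R mat 1"

definition Nball :: "(real^3) riem" where
  "Nball = \<lparr>Top = euclidean, Atlas = {ball_chart}, Metric = ball_metric\<rparr>"

lemma Nball_simps [simp]:
  "Top Nball = euclidean" "Atlas Nball = {ball_chart}" "Metric Nball = ball_metric"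
  by (simp_all add: Nball_def)

lemma ball_chart_simps [simp]: "fst ball_chart = UNIV" "snd ball_chart = (\<lambda>x. x)"
  by (simp_all add: ball_chart_def)

lemma conf_pos: "conf x > 0"
  by (simp add: conf_def add_pos_nonneg)

lemma Ck_on_conf: "open S \<Longrightarrow> Ck_on k conf S"
  unfolding conf_def[abs_def] by (intro Ck_on_intros)

lemma smooth_ball_metric: "smooth_on (ball_metric c) UNIV"
  unfolding smooth_on_def ball_metric_def[abs_def] by (intro allI Ck_on_intros Ck_on_conf) auto

lemma bil_scaleR_mat: "bil (a *\<^sub>R mat 1) v w = a * (v \<bullet> w)"
  by (simp add: bil_def matrix_vector_mul_lid scaleR_matrix_vector_assoc[symmetric])

lemma transition_self: "transition ball_chart ball_chart = (\<lambda>x. x)"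
  by (auto simp: transition_def o_def inv_into_def)

lemma jacobian_ident: "jacobian (\<lambda>x. x) x = mat 1"
  by (simp add: jacobian_def matrix_id_mat_1 flip: id_def)

lemma smooth_tensor2_Nball: "smooth_tensor2 Nball T \<longleftrightarrow> smooth_on (T ball_chart) UNIV"
  by (auto simp: smooth_tensor2_def transition_self jacobian_ident)

lemma riemannian_Nball: "riemannian_3_manifold Nball"
proof -
  have "smooth_on (\<lambda>x::real^3. x) UNIV"
    by (simp add: smooth_on_def Ck_on_id)
  moreover have "transpose (ball_metric ball_chart x) = ball_metric ball_chart x" for x
    by (simp add: ball_metric_def transpose_def vec_eq_iff mat_def)
  moreover have "bil (ball_metric ball_chart x) v v > 0" if "v \<noteq> 0" for x v
    using that conf_pos[of x] by (simp add: ball_metric_def bil_scaleR_mat)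
  moreover have "second_countable (euclidean :: (real^3) topology)"
  proof -
    obtain \<B> :: "(real^3) set set" where \<B>: "countable \<B>" "\<And>C. C \<in> \<B> \<Longrightarrow> open C"
      "\<And>S. open S \<Longrightarrow> \<exists>U. U \<subseteq> \<B> \<and> S = \<Union>U"
      using univ_second_countable by metis
    have "\<exists>V\<in>\<B>. x \<in> V \<and> V \<subseteq> U" if "open U" "x \<in> U" for U x
      using \<B>(3)[OF that(1)] that(2) by blast
    then show ?thesis
      unfolding second_countable_def using \<B>(1,2) by (auto intro!: exI[of _ \<B>])
  qed
  ultimately show ?thesis
    by (auto simp: riemannian_3_manifold_def transition_self jacobian_ident
        smooth_tensor2_Nball smooth_ball_metric Hausdorff_space_euclidean homeomorphic_map_id[unfolded id_def])
qed

lemma partialI: "(f has_derivative f') (at x) \<Longrightarrow> partial i f x = f' (axis i 1)"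
  unfolding partial_def by (metis frechet_derivative_at)

lemma has_derivative_norm_square:
  "((\<lambda>x. x \<bullet> x) has_derivative (\<lambda>v. 2 * (x \<bullet> v))) (at (x::'a::real_inner))"
  by (auto intro!: derivative_eq_intros simp: inner_commute)

text \<open>The 2-form corresponding to the vector field \<open>F(|x|\<^sup>2) x\<close>, whose divergence is
  \<open>3 F(q) + 2 q F'(q)\<close> with \<open>q = |x|\<^sup>2\<close>.\<close>

definition radial_F :: "real \<Rightarrow> real" where
  "radial_F q = (let L = 10^6 in 1/24 + (3/4) * L * (1/3 - 2*q/5 + q^2/7)
     + (3/2) * L^2 * (1/3 - 4*q/5 + 6*q^2/7 - 4*q^3/9 + q^4/11)
     + L^3 * (1/3 - 6*q/5 + 15*q^2/7 - 20*q^3/9 + 15*q^4/11 - 6*q^5/13 + q^6/15))"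

definition radial_F' :: "real \<Rightarrow> real" where
  "radial_F' q = (let L = 10^6 in (3/4) * L * (- 2/5 + 2*q/7)
     + (3/2) * L^2 * (- 4/5 + 12*q/7 - 12*q^2/9 + 4*q^3/11)
     + L^3 * (- 6/5 + 30*q/7 - 60*q^2/9 + 60*q^3/11 - 30*q^4/13 + 6*q^5/15))"

lemma radial_F_deriv: "(radial_F has_real_derivative radial_F' q) (at q)"
  unfolding radial_F_def[abs_def] radial_F'_def Let_def
  by (auto intro!: derivative_eq_intros simp: field_simps)

text \<open>Termwise, 3 q^k + 2 q (k q^(k-1)) = (2k+3) q^k: the coefficient of q^k in
  \<open>radial_F\<close> is the one in the expanded cube divided by 2k+3, whence the denominators
  3, 5, ..., 15.\<close>

lemma radial_F_divergence: "3 * radial_F q + 2 * q * radial_F' q = (1/2 + 10^6 * (1 - q)^2)^3"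
  unfolding radial_F_def radial_F'_def Let_def by (simp add: field_simps) algebra

text \<open>The coefficients of the 2-form that sends v, w to det (x, v, w), the contraction of the
  Euclidean volume form with the position vector.\<close>

definition cross_matrix :: "real^3 \<Rightarrow> real^3^3" where
  "cross_matrix x = (\<chi> i j. if i = 2 \<and> j = 3 then x$1 else if i = 3 \<and> j = 2 then - x$1
     else if i = 3 \<and> j = 1 then x$2 else if i = 1 \<and> j = 3 then - x$2
     else if i = 1 \<and> j = 2 then x$3 else if i = 2 \<and> j = 1 then - x$3 else 0)"

lemma bounded_linear_cross_matrix: "bounded_linear cross_matrix"
  unfolding linear_conv_bounded_linear[symmetric]
  by (rule linearI) (auto simp: cross_matrix_def vec_eq_iff)

definition radial_primitive :: "(real^3) tensor2" where
  "radial_primitive c x = radial_F (x \<bullet> x) *\<^sub>R cross_matrix x"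

lemma smooth_radial_primitive: "smooth_on (radial_primitive c) UNIV"
proof -
  have "Ck_on k (\<lambda>x::real^3. radial_F (x \<bullet> x)) UNIV" for k
    unfolding radial_F_def Let_def divide_inverse by (intro Ck_on_intros open_UNIV)
  then show ?thesis
    unfolding smooth_on_def radial_primitive_def[abs_def]
    by (intro allI Ck_on_scaleR Ck_on_linear[OF open_UNIV bounded_linear_cross_matrix] open_UNIV)
qed

lemma radial_primitive_has_derivative:
  "(radial_primitive c has_derivative (\<lambda>v. radial_F (x \<bullet> x) *\<^sub>R cross_matrix v
     + ((2 * (x \<bullet> v)) * radial_F' (x \<bullet> x)) *\<^sub>R cross_matrix x)) (at x)"
  unfolding radial_primitive_def[abs_def]
  by (intro has_derivative_scaleR DERIV_compose_FDERIV[OF radial_F_deriv] has_derivative_norm_square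
      bounded_linear_imp_has_derivative bounded_linear_cross_matrix)

lemma sqrt_det_ball_metric: "sqrt (det (ball_metric c x)) = conf x ^ 3"
proof -
  have "det (ball_metric c x) = (conf x ^ 3)^2"
    by (simp add: ball_metric_def det_3 mat_def power2_eq_square power3_eq_cube)
  then show ?thesis using conf_pos[of x] by (intro real_sqrt_unique) (auto intro: less_imp_le)
qed

text \<open>Shows that the later quantification over all volume primitives is not vacuous.\<close>

lemma volume_primitive_radial_primitive: "volume_primitive Nball M radial_primitive"
proof -
  have "partial 1 (radial_primitive c) x $ 2 $ 3 + partial 2 (radial_primitive c) x $ 3 $ 1 + partial 3 (radial_primitive c) x $ 1 $ 2
      = conf x ^ 3" for c x
  proof -
    have "partial 1 (radial_primitive c) x $ 2 $ 3 + partial 2 (radial_primitive c) x $ 3 $ 1 + partial 3 (radial_primitive c) x $ 1 $ 2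
      = 3 * radial_F (x \<bullet> x) + 2 * (x \<bullet> x) * radial_F' (x \<bullet> x)"
      unfolding partialI[OF radial_primitive_has_derivative]
      by (simp add: cross_matrix_def axis_def inner_vec_def sum_3 algebra_simps)
    then show ?thesis by (simp add: radial_F_divergence conf_def)
  qed
  moreover have "transpose (radial_primitive c x) = - radial_primitive c x" for c x
    by (simp add: radial_primitive_def cross_matrix_def vec_eq_iff transpose_def forall_3)
  ultimately show ?thesis
    by (simp add: volume_primitive_def smooth_tensor2_Nball smooth_radial_primitive sqrt_det_ball_metric)
qed

section \<open>Boundary points of the ball\<close>

lemma eventually_sign_on_ray:
  fixes f :: "'a::real_normed_vector \<Rightarrow> real"
  assumes f: "(f has_derivative D) (at p)" and "f p = 0"
  shows "D v < 0 \<Longrightarrow> \<forall>\<^sub>F t in at_right 0. f (p + t *\<^sub>R v) < 0"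
    and "D v > 0 \<Longrightarrow> \<forall>\<^sub>F t in at_right 0. f (p + t *\<^sub>R v) > 0"
proof -
  have "((\<lambda>t. f (p + t *\<^sub>R v)) has_derivative (\<lambda>h. D (h *\<^sub>R v))) (at (0::real))"
    by (rule has_derivative_compose[where f="\<lambda>t. p + t *\<^sub>R v" and g=f])
      (use f in \<open>auto intro!: derivative_eq_intros\<close>)
  moreover have "D (h *\<^sub>R v) = D v * h" for h
    using f by (simp add: has_derivative_def bounded_linear.linear linear_cmul)
  ultimately have d: "((\<lambda>t. f (p + t *\<^sub>R v)) has_real_derivative D v) (at 0)"
    by (simp add: has_field_derivative_def)
  show "\<forall>\<^sub>F t in at_right 0. f (p + t *\<^sub>R v) < 0" if "D v < 0"
    using DERIV_neg_dec_right[OF d that] \<open>f p = 0\<close> by (auto simp: eventually_at_right_field)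
  show "\<forall>\<^sub>F t in at_right 0. f (p + t *\<^sub>R v) > 0" if "D v > 0"
    using DERIV_pos_inc_right[OF d that] \<open>f p = 0\<close> by (auto simp: eventually_at_right_field)
qed

text \<open>By approximation from the open half-space, \<open>D\<close> is nonpositive on the
  bounding hyperplane as well; that hyperplane contains \<open>-v\<close> with \<open>v\<close>, so
  \<open>D\<close> vanishes on it.\<close>

lemma linear_nonpos_on_halfspace:
  fixes p :: "'a::real_inner"
  assumes "linear D" "norm p = 1" and D: "\<And>v. p \<bullet> v < 0 \<Longrightarrow> D v \<le> (0::real)"
  shows "D v = (p \<bullet> v) * D p"
proof -
  have pp: "p \<bullet> p = 1" using \<open>norm p = 1\<close> by (simp add: dot_square_norm)
  have le: "D v \<le> 0" if "p \<bullet> v = 0" for v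
  proof (rule field_le_epsilon)
    fix e :: real assume "e > 0"
    define d where "d = e / (1 + \<bar>D p\<bar>)"
    have "d > 0" using \<open>e > 0\<close> by (simp add: d_def)
    have "D (v - d *\<^sub>R p) \<le> 0" by (rule D) (use that pp \<open>d > 0\<close> in \<open>simp add: inner_diff_right\<close>)
    then have "D v \<le> d * D p" using \<open>linear D\<close> by (simp add: linear_diff linear_cmul)
    also have "\<dots> \<le> d * (1 + \<bar>D p\<bar>)" using \<open>d > 0\<close> by (intro mult_left_mono) auto
    also have "\<dots> = e" by (simp add: d_def add_nonneg_eq_0_iff add_pos_nonneg)
    finally show "D v \<le> 0 + e" by simp
  qed
  have "D (v - (p \<bullet> v) *\<^sub>R p) = 0"
    using le[of "v - (p \<bullet> v) *\<^sub>R p"] le[of "- (v - (p \<bullet> v) *\<^sub>R p)"] pp \<open>linear D\<close>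
    by (simp add: inner_diff_right linear_neg del: minus_diff_eq)
  then show ?thesis using \<open>linear D\<close> by (simp add: linear_diff linear_cmul)
qed

text \<open>Needed because convexity demands an angle below pi at every edge point. At an edge point
  of the sphere, both face functions would be nonincreasing to first order in every inward
  direction, so both derivatives would be multiples of the functional \<open>p \<bullet> v\<close>,
  against transversality.\<close>

lemma not_edge_point_ball:
  assumes p: "norm p = 1"
  shows "\<not> edge_point Nball (cball 0 1) p"
proof
  assume "edge_point Nball (cball 0 1) p"
  then obtain c V f1 f2 where r: "regular_equation f1 V (snd c p)" "regular_equation f2 V (snd c p)"
    and ind: "\<forall>y\<in>V. \<forall>a b. (\<forall>v. a * frechet_derivative f1 (at y) v + b * frechet_derivative f2 (at y) v = 0)
                   \<longrightarrow> a = 0 \<and> b = 0"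
    and sh: "local_shape Nball (cball 0 1) p c V {x. f1 x \<le> 0 \<and> f2 x \<le> 0} \<or>
         local_shape Nball (cball 0 1) p c V {x. f1 x \<le> 0 \<or> f2 x \<le> 0}"
    unfolding edge_point_def by blast
  have V: "open V" "p \<in> V" "c = ball_chart"
    using sh by (auto simp: local_shape_def)
  have sh': "cball 0 1 \<inter> V = {x. f1 x \<le> 0 \<and> f2 x \<le> 0} \<inter> V \<or>
      cball 0 1 \<inter> V = {x. f1 x \<le> 0 \<or> f2 x \<le> 0} \<inter> V"
    using sh V by (auto simp: local_shape_def)
  define D where "D f = frechet_derivative f (at p)" for f :: "real^3 \<Rightarrow> real"
  have der: "(f has_derivative D f) (at p)" "f p = 0" if "f \<in> {f1, f2}" for f
  proof -
    have "Ck_on (Suc 0) f V" "f p = 0"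
      using r that V by (auto simp: regular_equation_def smooth_on_def simp del: Ck_on.simps)
    then show "(f has_derivative D f) (at p)" "f p = 0"
      using Ck_on_Suc_has_derivative[of V 0 f p] V by (auto simp: D_def simp del: Ck_on.simps)
  qed
  have q: "((\<lambda>x. x \<bullet> x - 1) has_derivative (\<lambda>v. 2 * (p \<bullet> v))) (at p)"
    using has_derivative_norm_square[of p] by (rule has_derivative_diff[where g'="\<lambda>_. 0", simplified]) auto
  have q0: "p \<bullet> p - 1 = 0" using p by (simp add: dot_square_norm)
  have inV: "\<forall>\<^sub>F t in at_right 0. p + t *\<^sub>R v \<in> V" for v
  proof -
    have "((\<lambda>t. p + t *\<^sub>R v) \<longlongrightarrow> p + 0 *\<^sub>R v) (at_right (0::real))"
      by (intro tendsto_intros)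
    then show ?thesis using V by (auto dest: topological_tendstoD)
  qed
  have cb: "x \<in> cball 0 1 \<longleftrightarrow> x \<bullet> x - 1 \<le> 0" for x :: "real^3"
    by (simp add: dot_square_norm power_le_one_iff abs_square_le_1)
  have lin: "linear (D f)" if "f \<in> {f1, f2}" for f
    using der(1)[OF that] has_derivative_linear by blast
  have neg: "D f v \<le> 0" if f: "f \<in> {f1, f2}" and "p \<bullet> v < 0" for f v
    using sh'
  proof
    \<comment> \<open>An inward ray stays in the ball, where both functions are nonpositive.\<close>
    assume S: "cball 0 1 \<inter> V = {x. f1 x \<le> 0 \<and> f2 x \<le> 0} \<inter> V"
    show "D f v \<le> 0"
    proof (rule ccontr)
      assume "\<not> D f v \<le> 0"
      then have "\<forall>\<^sub>F t in at_right 0. f (p + t *\<^sub>R v) > 0"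
        using eventually_sign_on_ray(2)[OF der[OF f]] by simp
      moreover have "\<forall>\<^sub>F t in at_right 0. (p + t *\<^sub>R v) \<bullet> (p + t *\<^sub>R v) - 1 < 0"
        by (rule eventually_sign_on_ray(1)[OF q q0]) (use that in simp)
      ultimately have "\<forall>\<^sub>F t in at_right (0::real). False"
        using inV[of v]
      proof eventually_elim
        case (elim t)
        then have "p + t *\<^sub>R v \<in> cball 0 1 \<inter> V" using cb by auto
        then have "f (p + t *\<^sub>R v) \<le> 0" unfolding S using f by auto
        then show ?case using elim by simp
      qed
      then show False by simp
    qed
  next
    \<comment> \<open>Here one negative function already forces a point into the ball, so the
      contradiction comes from the outward ray, which leaves the ball.\<close>
    assume S: "cball 0 1 \<inter> V = {x. f1 x \<le> 0 \<or> f2 x \<le> 0} \<inter> V"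
    show "D f v \<le> 0"
    proof (rule ccontr)
      assume "\<not> D f v \<le> 0"
      then have "D f (-v) < 0" using lin[OF f] by (simp add: linear_neg)
      then have "\<forall>\<^sub>F t in at_right 0. f (p + t *\<^sub>R (-v)) < 0"
        by (rule eventually_sign_on_ray(1)[OF der[OF f]])
      moreover have "\<forall>\<^sub>F t in at_right 0. (p + t *\<^sub>R (-v)) \<bullet> (p + t *\<^sub>R (-v)) - 1 > 0"
        by (rule eventually_sign_on_ray(2)[OF q q0]) (use that in simp)
      ultimately have "\<forall>\<^sub>F t in at_right (0::real). False"
        using inV[of "-v"]
      proof eventually_elim
        case (elim t)
        then have "p + t *\<^sub>R (-v) \<in> cball 0 1 \<inter> V" unfolding S using f by auto
        then have "(p + t *\<^sub>R (-v)) \<bullet> (p + t *\<^sub>R (-v)) - 1 \<le> 0" using cb by blast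
        then show ?case using elim by simp
      qed
      then show False by simp
    qed
  qed
  have D: "D f v = (p \<bullet> v) * D f p" if "f \<in> {f1, f2}" for f v
    using linear_nonpos_on_halfspace[OF lin[OF that] p] neg[OF that] by blast
  have ind': "a = 0 \<and> b = 0" if "\<And>v. a * D f1 v + b * D f2 v = 0" for a b
    using ind V(2) that unfolding D_def by blast
  \<comment> \<open>Proportional functionals satisfy the relation with these crossed coefficients.
    Independence makes both vanish, and then the coefficients 1 and 0 give a second, contradictory
    relation.\<close>
  have *: "D f2 p = 0 \<and> - D f1 p = 0"
  proof (rule ind')
    show "D f2 p * D f1 v + - D f1 p * D f2 v = 0" for v
      using D[of f1 v] D[of f2 v] by (simp del: mult_eq_0_iff)
  qed
  have "(1::real) = 0 \<and> (0::real) = 0"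
  proof (rule ind')
    show "1 * D f1 v + 0 * D f2 v = 0" for v
      using D[of f1 v] * by simp
  qed
  then show False by simp
qed

lemma smooth_point_ball:
  assumes p: "norm p = 1"
  shows "smooth_point Nball (cball 0 1) p"
proof -
  let ?f = "\<lambda>x::real^3. x \<bullet> x - 1"
  have d: "(?f has_derivative (\<lambda>v. 2 * (y \<bullet> v))) (at y)" for y
    using has_derivative_norm_square[of y] by (rule has_derivative_diff[where g'="\<lambda>_. 0", simplified]) auto
  have fd: "frechet_derivative ?f (at y) \<noteq> (\<lambda>_. 0)" if "y \<noteq> 0" for y
  proof
    assume "frechet_derivative ?f (at y) = (\<lambda>_. 0)"
    then have "(\<lambda>v. 2 * (y \<bullet> v)) = (\<lambda>_. 0)" using frechet_derivative_at[OF d[of y]] by metis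
    then have "2 * (y \<bullet> y) = 0" by metis
    then show False using that by simp
  qed
  \<comment> \<open>The origin is the only critical point of the defining function, and a regular
    equation admits none in its neighbourhood.\<close>
  have "smooth_on ?f (-{0})"
    unfolding smooth_on_def by (intro allI Ck_on_intros) auto
  with fd have "regular_equation ?f (-{0}) (snd ball_chart p)"
    using p by (simp add: regular_equation_def dot_square_norm)
  moreover have "cball 0 1 = {x::real^3. x \<bullet> x - 1 \<le> 0}"
    by (auto simp: dot_square_norm power_le_one_iff abs_square_le_1)
  then have "local_shape Nball (cball 0 1) p ball_chart (-{0}) {x. ?f x \<le> 0}"
    using p by (auto simp: local_shape_def)
  ultimately show ?thesis
    unfolding smooth_point_def by blast
qed

lemma compact_domain_ball: "compact_domain Nball (cball 0 1)"
proof -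
  have "smooth_point Nball (cball 0 1) p" if "p \<in> bdry Nball (cball 0 1)" for p
    using that by (intro smooth_point_ball) (auto simp: frontier_cball)
  then have "{p \<in> bdry Nball (cball 0 1). \<not> smooth_point Nball (cball 0 1) p
      \<and> \<not> edge_point Nball (cball 0 1) p} = {}"
    and "\<forall>p\<in>bdry Nball (cball 0 1). smooth_point Nball (cball 0 1) p"
    by blast+
  then show ?thesis
    unfolding compact_domain_def using riemannian_Nball
    by (metis (no_types, lifting) Nball_simps(1) cball_eq_empty compact_cball compactin_euclidean_iff
        finite.emptyI not_one_less_zero)
qed

section \<open>Mean curvature of the boundary sphere\<close>

lemma matrix_inv_scaled_mat:
  assumes "a \<noteq> 0"
  shows "matrix_inv (a *\<^sub>R mat 1 :: real^'n^'n) = (1/a) *\<^sub>R mat 1"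
proof -
  let ?A = "a *\<^sub>R mat 1 :: real^'n^'n" and ?B = "(1/a) *\<^sub>R mat 1 :: real^'n^'n"
  have AB: "?A ** ?B = mat 1" "?B ** ?A = mat 1"
    using assms by (simp_all add: matrix_scalar_ac scalar_matrix_assoc[symmetric])
  then have "invertible ?A" by (auto simp: invertible_def)
  then have inv: "?A ** matrix_inv ?A = mat 1" "matrix_inv ?A ** ?A = mat 1"
    unfolding invertible_def matrix_inv_def by (metis (mono_tags, lifting) someI_ex)+
  have "matrix_inv ?A = matrix_inv ?A ** (?A ** ?B)" by (simp only: AB matrix_mul_rid)
  also have "\<dots> = ?B" by (simp only: matrix_mul_assoc inv matrix_mul_lid)
  finally show ?thesis .
qed

lemma partial_ball_metric_sphere:
  assumes "norm p = 1"
  shows "partial i (ball_metric c) p = 0"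
proof -
  have "(ball_metric c has_derivative (\<lambda>v. 0)) (at p)"
    unfolding ball_metric_def[abs_def] conf_def
    by (rule derivative_eq_intros has_derivative_norm_square refl | simp add: assms dot_square_norm)+
  then show ?thesis by (rule partialI)
qed

lemma conf_sphere: "norm p = 1 \<Longrightarrow> conf p = 1/2"
  by (simp add: conf_def dot_square_norm)

lemma christoffel_sphere: "norm p = 1 \<Longrightarrow> christoffel (ball_metric c) p v w = 0"
  by (simp add: christoffel_def partial_ball_metric_sphere vec_eq_iff)

lemma has_derivative_component: "((\<lambda>w. w $ i) has_derivative (\<lambda>v. v $ i)) (at (w::real^'n))"
  by (intro bounded_linear_imp_has_derivative bounded_linear_vec_nth)

text \<open>Longitude and latitude, with \<open>p\<close> at the parameter 0 and the poles at
  \<open>b\<close> and \<open>- b\<close>: for an orthonormal triple the coordinate frame at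
  \<open>p\<close> is orthonormal.\<close>

definition sphere_param :: "real^3 \<Rightarrow> real^3 \<Rightarrow> real^3 \<Rightarrow> real^2 \<Rightarrow> real^3" where
  "sphere_param p a b w = (cos (w$1) * cos (w$2)) *\<^sub>R p + (sin (w$1) * cos (w$2)) *\<^sub>R a + sin (w$2) *\<^sub>R b"

lemma sphere_param_has_derivative:
  "(sphere_param p a b has_derivative (\<lambda>v.
      v$1 *\<^sub>R ((- sin (w$1) * cos (w$2)) *\<^sub>R p + (cos (w$1) * cos (w$2)) *\<^sub>R a)
    + v$2 *\<^sub>R ((- cos (w$1) * sin (w$2)) *\<^sub>R p - (sin (w$1) * sin (w$2)) *\<^sub>R a + cos (w$2) *\<^sub>R b))) (at w)"
  unfolding sphere_param_def[abs_def]
  by (rule derivative_eq_intros has_derivative_component refl)+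
    (simp add: fun_eq_iff algebra_simps)

lemma partial_sphere_param:
  "partial 1 (sphere_param p a b) = (\<lambda>w. (- sin (w$1) * cos (w$2)) *\<^sub>R p + (cos (w$1) * cos (w$2)) *\<^sub>R a)"
  "partial 2 (sphere_param p a b) = (\<lambda>w. (- cos (w$1) * sin (w$2)) *\<^sub>R p - (sin (w$1) * sin (w$2)) *\<^sub>R a + cos (w$2) *\<^sub>R b)"
  by (rule ext, subst partialI[OF sphere_param_has_derivative], simp add: axis_def)+

lemma partial_partial_sphere_param_0:
  "partial i (partial j (sphere_param p a b)) 0 = (if i = j then - p else 0)"
proof -
  have 1: "(partial 1 (sphere_param p a b) has_derivative (\<lambda>v. - v$1 *\<^sub>R p)) (at 0)"
    unfolding partial_sphere_param
    by (rule derivative_eq_intros has_derivative_component refl)+ (simp add: fun_eq_iff)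
  have 2: "(partial 2 (sphere_param p a b) has_derivative (\<lambda>v. - v$2 *\<^sub>R p)) (at 0)"
    unfolding partial_sphere_param
    by (rule derivative_eq_intros has_derivative_component refl)+ (simp add: fun_eq_iff)
  have "\<forall>i j. partial i (partial j (sphere_param p a b)) 0 = (if i = j then - p else 0)"
    unfolding forall_2 partialI[OF 1] partialI[OF 2] by (simp add: axis_def)
  then show ?thesis by blast
qed

locale orthonormal_triple =
  fixes p a b :: "real^3"
  assumes orthonormal [simp]: "p \<bullet> p = 1" "a \<bullet> a = 1" "b \<bullet> b = 1" "p \<bullet> a = 0" "p \<bullet> b = 0" "a \<bullet> b = 0"
begin

lemma orthonormal' [simp]: "a \<bullet> p = 0" "b \<bullet> p = 0" "b \<bullet> a = 0"
  using orthonormal by (simp_all add: inner_commute)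

lemma norm_p: "norm p = 1"
  by (simp add: norm_eq_1)

lemma sphere_param_0: "sphere_param p a b 0 = p"
  by (simp add: sphere_param_def)

lemma norm_sphere_param: "norm (sphere_param p a b w) = 1"
proof -
  have "sphere_param p a b w \<bullet> sphere_param p a b w
      = (cos (w$1))^2 * (cos (w$2))^2 + (sin (w$1))^2 * (cos (w$2))^2 + (sin (w$2))^2"
    by (simp add: sphere_param_def inner_simps power2_eq_square algebra_simps)
  also have "\<dots> = ((sin (w$1))^2 + (cos (w$1))^2) * (cos (w$2))^2 + (sin (w$2))^2"
    by (simp only: algebra_simps)
  also have "\<dots> = 1" by (simp only: sin_cos_squared_add2 sin_cos_squared_add3 sin_cos_squared_add mult_1)
  finally show ?thesis by (simp add: norm_eq_1)
qed

text \<open>The metric halves lengths on the sphere, so the inverse first form is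
  \<open>4 *\<^sub>R mat 1\<close>; the two pure second derivatives are \<open>- p\<close>, and the
  Christoffel symbols vanish. Half the trace is then \<open>-4 *\<^sub>R p\<close>, of metric length
  2.\<close>

lemma mean_curvature_sphere_param:
  "mean_curvature_vector (ball_metric c) (sphere_param p a b) 0 = -4 *\<^sub>R p"
proof -
  let ?F = "sphere_param p a b"
  have g: "ball_metric c p = (1/4) *\<^sub>R mat 1"
    by (simp add: ball_metric_def conf_sphere norm_p power2_eq_square)
  have ff: "first_form (ball_metric c) ?F 0 = (1/4) *\<^sub>R mat 1"
    unfolding first_form_def sphere_param_0 g bil_scaleR_mat
    by (simp add: partial_sphere_param vec_eq_iff forall_2 mat_def)
  have inv: "matrix_inv (first_form (ball_metric c) ?F 0) = 4 *\<^sub>R mat 1"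
    unfolding ff by (subst matrix_inv_scaled_mat) auto
  have np: "normal_part (ball_metric c) ?F 0 (-p) = - p"
    unfolding normal_part_def inv sphere_param_0 g bil_scaleR_mat
    by (simp add: partial_sphere_param sum_2 mat_def)
  have "normal_part (ball_metric c) ?F 0 0 = 0"
    by (simp add: normal_part_def bil_def)
  then have sf: "second_form (ball_metric c) ?F 0 i j = (if i = j then - p else 0)" for i j
    using np by (simp add: second_form_def partial_partial_sphere_param_0 sphere_param_0 christoffel_sphere norm_p)
  show ?thesis
    unfolding mean_curvature_vector_def inv sf by (simp add: sum_2 mat_def scaleR_add_left[symmetric])
qed

lemma boundary_mean_curvature_ball:
  "boundary_mean_curvature Nball (cball 0 1) p ball_chart (-4 *\<^sub>R p)"
proof -
  have "inj (frechet_derivative (sphere_param p a b) (at w))" if "w \<in> ball 0 1" for w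
  proof -
    \<comment> \<open>The coordinates degenerate only at the poles; the unit parameter disk keeps
      the latitude below 1 < pi/2.\<close>
    have "\<bar>w$2\<bar> \<le> norm w" by (rule component_le_norm_cart)
    also have "\<dots> < 1" using that by simp
    finally have c: "cos (w$2) > 0" using pi_gt3 by (intro cos_gt_zero_pi) auto
    define T where "T = frechet_derivative (sphere_param p a b) (at w)"
    have T: "T v = v$1 *\<^sub>R ((- sin (w$1) * cos (w$2)) *\<^sub>R p + (cos (w$1) * cos (w$2)) *\<^sub>R a)
      + v$2 *\<^sub>R ((- cos (w$1) * sin (w$2)) *\<^sub>R p - (sin (w$1) * sin (w$2)) *\<^sub>R a + cos (w$2) *\<^sub>R b)" for v
      unfolding T_def frechet_derivative_at[OF sphere_param_has_derivative, symmetric] ..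
    have "linear T"
      unfolding T_def frechet_derivative_at[OF sphere_param_has_derivative, symmetric]
      by (rule has_derivative_linear[OF sphere_param_has_derivative])
    moreover have "v = 0" if "T v = 0" for v
    proof -
      have "b \<bullet> T v = 0" using that by simp
      then have v2: "v$2 = 0" using c by (simp add: T inner_simps)
      have "p \<bullet> T v = 0" "a \<bullet> T v = 0" using that by simp_all
      then have "v$1 * sin (w$1) = 0" "v$1 * cos (w$1) = 0" using c by (simp_all add: T v2 inner_simps)
      then have "v$1 = 0" using sin_cos_squared_add[of "w$1"] by (auto simp del: sin_cos_squared_add)
      then show "v = 0" using v2 by (simp add: vec_eq_iff forall_2)
    qed
    ultimately show ?thesis unfolding T_def[symmetric] by (simp add: linear_injective_0)
  qed
  moreover have "smooth_on (sphere_param p a b) (ball 0 1)"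
    unfolding smooth_on_def sphere_param_def[abs_def]
    by (intro allI Ck_on_intros Ck_on_linear[OF _ bounded_linear_vec_nth] open_ball)
  ultimately show ?thesis
    unfolding boundary_mean_curvature_def
    by (intro exI[of _ "ball 0 1"] exI[of _ "sphere_param p a b"] exI[of _ 0])
      (auto simp: sphere_param_0 norm_sphere_param mean_curvature_sphere_param)
qed

end

lemma H0_convex_ball: "H0_convex 2 Nball (cball 0 1)"
proof -
  have "\<exists>h. boundary_mean_curvature Nball (cball 0 1) p ball_chart h \<and>
      points_inside Nball (cball 0 1) p ball_chart h \<and> gnorm (ball_metric ball_chart p) h \<ge> 2"
    if p: "norm p = 1" for p
  proof -
    have "norm (axis 3 1 :: real^3) = 1" by simp
    \<comment> \<open>An orthogonal map carrying the third basis vector to \<open>p\<close> carries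
      the other two to a tangent frame at \<open>p\<close>.\<close>
    with p obtain f :: "real^3 \<Rightarrow> real^3" where f: "orthogonal_transformation f" "f (axis 3 1) = p"
      using orthogonal_transformation_exists_1 by blast
    have "orthonormal_triple p (f (axis 1 1)) (f (axis 2 1))"
      unfolding f(2)[symmetric] using f(1)
      by unfold_locales (simp_all add: orthogonal_transformation_def inner_axis_axis)
    then have "boundary_mean_curvature Nball (cball 0 1) p ball_chart (-4 *\<^sub>R p)"
      by (rule orthonormal_triple.boundary_mean_curvature_ball)
    moreover have "norm (p + t *\<^sub>R (-4 *\<^sub>R p)) < 1" if "t \<in> {0<..<1/4}" for t
    proof -
      have "p + t *\<^sub>R (-4 *\<^sub>R p) = (1 - 4 * t) *\<^sub>R p" by (simp add: algebra_simps)
      then show ?thesis using that p by simp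
    qed
    then have "points_inside Nball (cball 0 1) p ball_chart (-4 *\<^sub>R p)"
      unfolding points_inside_def by (intro exI[of _ "1/4"]) (auto simp: interior_cball)
    moreover have "gnorm (ball_metric ball_chart p) (-4 *\<^sub>R p) = 2"
      using p by (simp add: gnorm_def ball_metric_def bil_scaleR_mat conf_sphere dot_square_norm power2_eq_square)
    ultimately show ?thesis by (intro exI[of _ "-4 *\<^sub>R p"]) simp
  qed
  moreover have "norm p = 1" if "p \<in> bdry Nball (cball 0 1)" for p
    using that by (simp add: frontier_cball)
  ultimately show ?thesis
    unfolding H0_convex_def using compact_domain_ball not_edge_point_ball by auto
qed

section \<open>The equator as a Jordan curve that contracts in the ball\<close>

definition equator_emb :: "real^2 \<Rightarrow> real^3" where
  "equator_emb z = z$1 *\<^sub>R axis 1 1 + z$2 *\<^sub>R axis 2 1"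

lemma equator_emb_nth [simp]:
  "equator_emb z $ 1 = z $ 1" "equator_emb z $ 2 = z $ 2" "equator_emb z $ 3 = 0"
  by (simp_all add: equator_emb_def axis_def)

lemma bounded_linear_equator_emb: "bounded_linear equator_emb"
  unfolding equator_emb_def[abs_def]
  by (intro bounded_linear_add bounded_linear_scaleR_const bounded_linear_vec_nth)

lemma norm_equator_emb: "norm (equator_emb z) = norm z"
  by (simp add: norm_eq_sqrt_inner inner_vec_def sum_2 sum_3)

lemma inj_equator_emb: "inj equator_emb"
  by (rule injI) (simp add: vec_eq_iff forall_2 forall_3)

definition equator :: "(real^3) set" where "equator = equator_emb ` sphere 0 1"

lemma embedding_map_circle:
  fixes f :: "real^2 \<Rightarrow> 'a::metric_space"
  assumes "continuous_on (sphere 0 1) f" "inj_on f (sphere 0 1)" "f ` sphere 0 1 \<subseteq> T"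
  shows "embedding_map circle (top_of_set T) f"
  by (rule continuous_imp_embedding_map)
    (use assms in \<open>auto simp: compact_space_subtopology Hausdorff_space_subtopology[OF Hausdorff_space_euclidean] image_subset_iff_funcset\<close>)

lemma embedding_map_equator: "equator \<subseteq> T \<Longrightarrow> embedding_map circle (top_of_set T) equator_emb"
  by (rule embedding_map_circle)
    (auto simp: equator_def linear_continuous_on bounded_linear_equator_emb
      intro: inj_on_subset[OF inj_equator_emb])

lemma equator_subset_sphere: "equator \<subseteq> sphere 0 1"
  by (auto simp: equator_def norm_equator_emb)

lemma jordan_equator: "jordan_curve_in (subtopology (Top Nball) (bdry Nball (cball 0 1))) equator"
  unfolding jordan_curve_in_def
  using embedding_map_equator[OF equator_subset_sphere]
  by (auto simp: equator_def frontier_cball intro!: exI[of _ equator_emb])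

lemma nullhomotopic_equator: "nullhomotopic_curve_in (subtopology (Top Nball) (cball 0 1)) equator"
proof -
  have sub: "equator \<subseteq> cball 0 1"
    using equator_subset_sphere sphere_cball by blast
  have "homotopic_with_canon (\<lambda>_. True) (sphere 0 1) (cball 0 1) equator_emb (\<lambda>_. 0)"
  proof (rule homotopic_with_linear)
    show "closed_segment (equator_emb x) 0 \<subseteq> cball 0 1" if "x \<in> sphere 0 1" for x
      using that by (intro closed_segment_subset) (auto simp: norm_equator_emb)
  qed (auto simp: linear_continuous_on bounded_linear_equator_emb)
  then show ?thesis
    unfolding nullhomotopic_curve_in_def using embedding_map_equator[OF sub]
    by (intro exI[of _ equator_emb]) (auto simp: equator_def)
qed

section \<open>Disks wrapping around a torus of revolution\<close>

definition glue :: "(real \<Rightarrow> real) \<Rightarrow> (real \<Rightarrow> real) \<Rightarrow> real \<Rightarrow> real" where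
  "glue f g q = (if q \<ge> 1 then f q else g q)"

text \<open>Each formula only has to be differentiable on its own closed half-line, as the logarithm
  and the square root of the outer one break down at 0. At 1 the difference quotients are compared
  one side at a time.\<close>

lemma glue_has_derivative:
  assumes f: "\<And>q. q \<ge> 1 \<Longrightarrow> (f has_real_derivative f' q) (at q)"
    and g: "\<And>q. q \<le> 1 \<Longrightarrow> (g has_real_derivative g' q) (at q)"
    and eq: "f 1 = g 1" "f' 1 = g' 1"
  shows "(glue f g has_real_derivative glue f' g' q) (at q)"
proof -
  consider "q > 1" | "q < 1" | "q = 1" by linarith
  then show ?thesis
  proof cases
    case 1
    then have "(f has_real_derivative glue f' g' q) (at q)" using f[of q] by (simp add: glue_def)
    then show ?thesis
      by (rule has_field_derivative_transform_within_open[of _ _ _ "{1<..}"]) (use 1 in \<open>auto simp: glue_def\<close>)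
  next
    case 2
    then have "(g has_real_derivative glue f' g' q) (at q)" using g[of q] by (simp add: glue_def)
    then show ?thesis
      by (rule has_field_derivative_transform_within_open[of _ _ _ "{..<1}"]) (use 2 in \<open>auto simp: glue_def\<close>)
  next
    case 3
    have "((\<lambda>y. (f y - f 1) / (y - 1)) \<longlongrightarrow> f' 1) (at_right 1)"
      using f[of 1] by (simp add: has_field_derivative_iff filterlim_at_split)
    moreover have "\<forall>\<^sub>F y in at_right 1. (f y - f 1) / (y - 1) = (glue f g y - glue f g 1) / (y - 1)"
      by (auto simp: eventually_at_filter glue_def)
    ultimately have r: "((\<lambda>y. (glue f g y - glue f g 1) / (y - 1)) \<longlongrightarrow> f' 1) (at_right 1)"
      by (rule Lim_transform_eventually)
    have "((\<lambda>y. (g y - g 1) / (y - 1)) \<longlongrightarrow> f' 1) (at_left 1)"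
      using g[of 1] eq by (simp add: has_field_derivative_iff filterlim_at_split)
    moreover have "\<forall>\<^sub>F y in at_left 1. (g y - g 1) / (y - 1) = (glue f g y - glue f g 1) / (y - 1)"
      by (auto simp: eventually_at_filter glue_def eq)
    ultimately have l: "((\<lambda>y. (glue f g y - glue f g 1) / (y - 1)) \<longlongrightarrow> f' 1) (at_left 1)"
      by (rule Lim_transform_eventually)
    show ?thesis
      using l r 3 by (simp add: has_field_derivative_iff filterlim_at_split glue_def)
  qed
qed

lemma continuous_on_glue:
  assumes f: "continuous_on {1..} f" and g: "continuous_on {..1} g" and eq: "f 1 = g 1"
  shows "continuous_on UNIV (glue f g)"
proof -
  have "continuous_on ({1..} \<union> {..1}) (\<lambda>q. if 1 \<le> q then f q else g q)"
    by (rule continuous_on_If) (use assms in \<open>auto intro: antisym\<close>)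
  moreover have "{1..} \<union> {..1} = (UNIV::real set)" by auto
  ultimately show ?thesis by (simp add: glue_def[abs_def])
qed

text \<open>The profile curve \<open>(sqrt q * sig q, zet q)\<close> with \<open>q = |w|\<^sup>2\<close>. For \<open>q \<ge> 1\<close> it runs around the
  circle of radius 1/3 about (2/3, 0), at angle \<open>ln q / 2\<close>; for \<open>q < 1\<close> the functions \<open>sig\<close> and
  \<open>zet\<close> are continued by their Taylor polynomials of degree 2 at 1.\<close>

definition sig :: "real \<Rightarrow> real" where
  "sig = glue (\<lambda>q. (2/3 + cos (ln q / 2) / 3) / sqrt q) (\<lambda>q. 1 + (1 - q) / 2 + (1 - q)^2 / 3)"
definition sig1 :: "real \<Rightarrow> real" where
  "sig1 = glue (\<lambda>q. (- sin (ln q / 2) / 3 - 2/3 - cos (ln q / 2) / 3) / (2 * q * sqrt q))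
     (\<lambda>q. - 1/2 - 2 * (1 - q) / 3)"
definition sig2 :: "real \<Rightarrow> real" where
  "sig2 = glue (\<lambda>q. (2 * cos (ln q / 2) / 3 + 4 * sin (ln q / 2) / 3 + 2) / (4 * q^2 * sqrt q)) (\<lambda>q. 2/3)"
definition zet :: "real \<Rightarrow> real" where
  "zet = glue (\<lambda>q. sin (ln q / 2) / 3) (\<lambda>q. - ((1 - q) / 2 + (1 - q)^2 / 4) / 3)"
definition zet1 :: "real \<Rightarrow> real" where
  "zet1 = glue (\<lambda>q. cos (ln q / 2) / (6 * q)) (\<lambda>q. 1/6 + (1 - q) / 6)"
definition zet2 :: "real \<Rightarrow> real" where
  "zet2 = glue (\<lambda>q. (- sin (ln q / 2) - 2 * cos (ln q / 2)) / (12 * q^2)) (\<lambda>q. - 1/6)"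

lemma DERIV_divide_sqrt:
  assumes "q > 0" and h: "(h has_real_derivative h') (at q)"
  shows "((\<lambda>q. h q / sqrt q) has_real_derivative (2 * q * h' - h q) / (2 * q * sqrt q)) (at q)"
proof -
  define s where "s = sqrt q"
  have s: "s > 0" "q = s * s" using \<open>q > 0\<close> by (simp_all add: s_def)
  have "((\<lambda>q. h q / sqrt q) has_real_derivative (h' * s - h q * (inverse s / 2)) / (s * s)) (at q)"
    unfolding s_def by (intro DERIV_divide h DERIV_real_sqrt) (use \<open>q > 0\<close> in auto)
  moreover have "(h' * s - h q * (inverse s / 2)) / (s * s) = (2 * q * h' - h q) / (2 * q * sqrt q)"
    unfolding s_def[symmetric] unfolding s(2) using s(1) by (simp add: field_simps)
  ultimately show ?thesis by simp
qed

lemma sig_deriv: "(sig has_real_derivative sig1 q) (at q)"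
  unfolding sig_def sig1_def
proof (rule glue_has_derivative)
  fix q :: real assume q: "q \<ge> 1"
  then have "((\<lambda>q. 2/3 + cos (ln q / 2) / 3) has_real_derivative - sin (ln q / 2) / (6 * q)) (at q)"
    by (auto intro!: derivative_eq_intros simp: field_simps)
  from DERIV_divide_sqrt[OF _ this] q
  show "((\<lambda>q. (2/3 + cos (ln q / 2) / 3) / sqrt q) has_real_derivative
     (- sin (ln q / 2) / 3 - 2/3 - cos (ln q / 2) / 3) / (2 * q * sqrt q)) (at q)"
    by (simp add: diff_diff_eq)
qed (auto intro!: derivative_eq_intros simp: field_simps)

lemma sig1_deriv: "(sig1 has_real_derivative sig2 q) (at q)"
  unfolding sig1_def sig2_def
proof (rule glue_has_derivative)
  fix q :: real assume q: "q \<ge> 1"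
  define C where "C = cos (ln q / 2)"
  define S where "S = sin (ln q / 2)"
  have "((\<lambda>q. (- sin (ln q / 2) / 3 - 2/3 - cos (ln q / 2) / 3) / (2 * q)) has_real_derivative
     (3 * S + C + 4) / (12 * q^2)) (at q)"
    unfolding C_def S_def using q
    by (auto intro!: derivative_eq_intros simp: field_simps power2_eq_square)
  from DERIV_divide_sqrt[OF _ this] q
  have "((\<lambda>q. (- sin (ln q / 2) / 3 - 2/3 - cos (ln q / 2) / 3) / (2 * q) / sqrt q) has_real_derivative
     (2 * q * ((3 * S + C + 4) / (12 * q^2)) - (- S / 3 - 2/3 - C / 3) / (2 * q)) / (2 * q * sqrt q)) (at q)"
    by (simp add: C_def S_def)
  moreover have "2 * q * ((3 * S + C + 4) / (12 * q^2)) - (- S / 3 - 2/3 - C / 3) / (2 * q)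
      = (2 * C / 3 + 4 * S / 3 + 2) / (2 * q)"
    using q by (simp add: power2_eq_square field_simps)
  ultimately show "((\<lambda>q. (- sin (ln q / 2) / 3 - 2/3 - cos (ln q / 2) / 3) / (2 * q * sqrt q)) has_real_derivative
     (2 * cos (ln q / 2) / 3 + 4 * sin (ln q / 2) / 3 + 2) / (4 * q^2 * sqrt q)) (at q)"
    unfolding C_def[symmetric] S_def[symmetric] by (simp add: power2_eq_square mult_ac)
qed (auto intro!: derivative_eq_intros simp: field_simps)

lemma zet_deriv: "(zet has_real_derivative zet1 q) (at q)"
  unfolding zet_def zet1_def
  by (rule glue_has_derivative) (auto intro!: derivative_eq_intros simp: field_simps)

lemma zet1_deriv: "(zet1 has_real_derivative zet2 q) (at q)"
  unfolding zet1_def zet2_def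
  by (rule glue_has_derivative) (auto intro!: derivative_eq_intros simp: field_simps power2_eq_square)

lemma sig2_cont: "continuous_on UNIV sig2"
  unfolding sig2_def by (rule continuous_on_glue) (auto intro!: continuous_intros)

lemma zet2_cont: "continuous_on UNIV zet2"
  unfolding zet2_def by (rule continuous_on_glue) (auto intro!: continuous_intros)

text \<open>Immersed disks are required to be \<open>C^2\<close>, which is exactly what matching
  values and two derivatives at 1 provides.\<close>

lemma Ck_on_2_compose_real:
  fixes f :: "'a::euclidean_space \<Rightarrow> real"
  assumes "open S" "Ck_on 2 f S"
    and g: "\<And>y. (g has_real_derivative g' y) (at y)" "\<And>y. (g' has_real_derivative g'' y) (at y)"
    and "continuous_on UNIV g''"
  shows "Ck_on 2 (\<lambda>x. g (f x)) S"
proof -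
  define G where "G n = (if n = 0 then g else if n = 1 then g' else g'')" for n :: nat
  have "Ck_on 2 (\<lambda>x. G 0 (f x)) S"
  proof (rule Ck_on_compose_real[OF assms(1,2)])
    show "(G n has_real_derivative G (Suc n) y) (at y)" if "n < 2" for n y
      using that g by (auto simp: G_def less_2_cases_iff)
    show "continuous_on UNIV (G 2)" using assms(5) by (simp add: G_def)
  qed
  then show ?thesis by (simp add: G_def)
qed

text \<open>A surface of revolution written through \<open>w \<bullet> w\<close> and the linear
  \<open>equator_emb w\<close> stays regular on the axis, where |w| is not differentiable.\<close>

definition wrap :: "real^2 \<Rightarrow> real^3" where
  "wrap w = sig (w \<bullet> w) *\<^sub>R equator_emb w + zet (w \<bullet> w) *\<^sub>R axis 3 1"

lemma Ck_on_wrap: "open S \<Longrightarrow> Ck_on 2 (\<lambda>z. wrap (a *\<^sub>R z)) S"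
  unfolding wrap_def[abs_def]
proof (intro Ck_on_add Ck_on_scaleR Ck_on_const)
  assume S: "open S"
  have q: "Ck_on 2 (\<lambda>z::real^2. (a *\<^sub>R z) \<bullet> (a *\<^sub>R z)) S"
    by (intro Ck_on_intros S)
  show "Ck_on 2 (\<lambda>z::real^2. sig ((a *\<^sub>R z) \<bullet> (a *\<^sub>R z))) S"
    by (rule Ck_on_2_compose_real[OF S q sig_deriv sig1_deriv sig2_cont])
  show "Ck_on 2 (\<lambda>z::real^2. zet ((a *\<^sub>R z) \<bullet> (a *\<^sub>R z))) S"
    by (rule Ck_on_2_compose_real[OF S q zet_deriv zet1_deriv zet2_cont])
  show "Ck_on 2 (\<lambda>z. equator_emb (a *\<^sub>R z)) S"
    by (intro Ck_on_linear S bounded_linear_compose[OF bounded_linear_equator_emb] bounded_linear_scaleR_right)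
qed

definition wrap' :: "real^2 \<Rightarrow> real^2 \<Rightarrow> real^3" where
  "wrap' w v = (2 * (w \<bullet> v) * sig1 (w \<bullet> w)) *\<^sub>R equator_emb w + sig (w \<bullet> w) *\<^sub>R equator_emb v
     + (2 * (w \<bullet> v) * zet1 (w \<bullet> w)) *\<^sub>R axis 3 1"

lemma wrap_has_derivative: "(wrap has_derivative wrap' w) (at w)"
proof -
  have "(wrap has_derivative (\<lambda>v. (sig (w \<bullet> w) *\<^sub>R equator_emb v + (2 * (w \<bullet> v) * sig1 (w \<bullet> w)) *\<^sub>R equator_emb w)
      + (zet (w \<bullet> w) *\<^sub>R 0 + (2 * (w \<bullet> v) * zet1 (w \<bullet> w)) *\<^sub>R axis 3 1))) (at w)"
    unfolding wrap_def[abs_def]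
    by (intro has_derivative_add has_derivative_scaleR DERIV_compose_FDERIV[OF sig_deriv]
        DERIV_compose_FDERIV[OF zet_deriv] has_derivative_norm_square has_derivative_const
        bounded_linear_imp_has_derivative bounded_linear_equator_emb)
  then show ?thesis by (simp add: wrap'_def[abs_def] add_ac)
qed

lemma sig_pos: "sig q > 0"
proof (cases "q \<ge> 1")
  case True
  have "2/3 + cos (ln q / 2) / 3 > 0" using cos_ge_minus_one[of "ln q / 2"] by linarith
  then show ?thesis using True by (simp add: sig_def glue_def)
next
  case False
  then show ?thesis by (simp add: sig_def glue_def add_pos_nonneg)
qed

text \<open>The profile curve has nonzero velocity: \<open>2 * q * sig1 q + sig q\<close> is the
  derivative of s sig(s^2) at s = sqrt q, the horizontal component. The height is strictly
  increasing on the cap, so \<open>zet1\<close> vanishes only at the top and bottom of the circle,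
  where the motion is horizontal.\<close>

lemma profile_regular:
  assumes "q \<ge> 0" "zet1 q = 0" shows "2 * q * sig1 q + sig q \<noteq> 0"
proof -
  have q: "q \<ge> 1" 
  proof (rule ccontr)
    assume "\<not> q \<ge> 1"
    then have "zet1 q > 0" by (simp add: zet1_def glue_def field_simps)
    then show False using assms by simp
  qed
  then have c: "cos (ln q / 2) = 0" using assms by (simp add: zet1_def glue_def)
  then have s: "sin (ln q / 2) \<noteq> 0" using sin_cos_squared_add[of "ln q / 2"] by auto
  have "2 * q * sig1 q + sig q = - sin (ln q / 2) / (3 * sqrt q)"
    using q c by (simp add: sig1_def sig_def glue_def field_simps)
  then show ?thesis using s q by simp
qed

lemma linear_wrap': "linear (wrap' w)"
  using wrap_has_derivative has_derivative_linear by blast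

lemma inj_wrap': "inj (wrap' w)"
proof -
  have "v = 0" if "wrap' w v = 0" for v
  proof -
    define q where "q = w \<bullet> w"
    have c: "2 * (w \<bullet> v) * sig1 q * w$1 + sig q * v$1 = 0"
       "2 * (w \<bullet> v) * sig1 q * w$2 + sig q * v$2 = 0" "2 * (w \<bullet> v) * zet1 q = 0"
      using arg_cong[OF that, of "\<lambda>x. x$1"] arg_cong[OF that, of "\<lambda>x. x$2"] arg_cong[OF that, of "\<lambda>x. x$3"]
      by (simp_all add: wrap'_def q_def axis_def)
    have "w \<bullet> v = 0"
    proof (rule ccontr)
      assume nz: "w \<bullet> v \<noteq> 0"
      then have "zet1 q = 0" using c(3) by simp
      then have "2 * q * sig1 q + sig q \<noteq> 0" by (intro profile_regular) (simp add: q_def)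
      \<comment> \<open>Pairing the horizontal equations with \<open>w\<close> leaves a single
        equation for the radial velocity of the profile.\<close>
      moreover have "(w \<bullet> v) * (2 * q * sig1 q + sig q)
        = w$1 * (2 * (w \<bullet> v) * sig1 q * w$1 + sig q * v$1) + w$2 * (2 * (w \<bullet> v) * sig1 q * w$2 + sig q * v$2)"
        unfolding q_def inner_vec_def by (simp add: sum_2 algebra_simps)
      ultimately show False using c nz by simp
    qed
    then have "v$1 = 0 \<and> v$2 = 0" using c sig_pos[of q] by simp
    then show "v = 0" by (simp add: vec_eq_iff forall_2)
  qed
  then show ?thesis using linear_wrap' linear_injective_0 by blast
qed

text \<open>On the torus the squared norm is 5/9 + 4/9 cos L. On the cap it is 1 plus a polynomial
  in p = 1 - q with no linear term, since the profile is tangent to the sphere at the equator, and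
  with negative coefficients otherwise.\<close>

lemma norm_wrap_le: "norm (wrap w) \<le> 1"
proof -
  define q where "q = w \<bullet> w"
  have "q \<ge> 0" by (simp add: q_def)
  have "wrap w \<bullet> wrap w = q * (sig q)^2 + (zet q)^2"
    by (simp add: wrap_def q_def inner_vec_def sum_2 sum_3 axis_def power2_eq_square algebra_simps)
  also have "\<dots> \<le> 1"
  proof (cases "q \<ge> 1")
    case True
    define L where "L = ln q / 2"
    have e1: "q * (sig q)^2 = (2/3 + cos L / 3)^2"
      using True by (simp add: sig_def glue_def L_def power_divide)
    have e2: "zet q = sin L / 3" using True by (simp add: zet_def glue_def L_def)
    have e3: "(2/3 + cos L / 3)^2 + (sin L / 3)^2 = 4/9 + 4/9 * cos L + ((sin L)^2 + (cos L)^2) / 9"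
      by (simp add: power2_eq_square field_simps
          del: sin_cos_squared_add sin_cos_squared_add2 sin_cos_squared_add3)
    show ?thesis unfolding e1 e2 e3 using cos_le_one[of L] by (simp add: field_simps)
  next
    case False
    define p where "p = 1 - q"
    have p: "0 \<le> p" "p \<le> 1" using False \<open>q \<ge> 0\<close> by (auto simp: p_def)
    have "q * (sig q)^2 + (zet q)^2 = (1 - p) * (1 + p/2 + p^2/3)^2 + ((p/2 + p^2/4) / 3)^2"
      using False by (simp add: sig_def zet_def glue_def p_def) (simp add: power2_eq_square field_simps)
    also have "\<dots> = 1 - p^2/18 - 5/9 * p^3 - 31/144 * p^4 - p^5/9"
      by (simp add: power2_eq_square power3_eq_cube power4_eq_xxxx eval_nat_numeral field_simps)
    also have "\<dots> \<le> 1"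
      using zero_le_power[OF p(1), of 2] zero_le_power[OF p(1), of 3] zero_le_power[OF p(1), of 4]
        zero_le_power[OF p(1), of 5] by linarith
    finally show ?thesis .
  qed
  finally have "(norm (wrap w))^2 \<le> 1" by (simp add: power2_norm_eq_inner)
  then show ?thesis by (simp add: power_le_one_iff abs_square_le_1)
qed

text \<open>At |w| = exp(2 pi n) the profile angle is 2 pi n, so the profile is back at (1, 0) and
  the boundary is the equator in its standard parametrization for every \<open>n\<close>.\<close>

lemma wrap_circle:
  assumes "norm z = 1"
  shows "wrap (exp (2 * pi * real n) *\<^sub>R z) = equator_emb z"
proof -
  define a where "a = exp (2 * pi * real n)"
  have "z \<bullet> z = 1" using assms by (simp add: norm_eq_1)
  then have q: "(a *\<^sub>R z) \<bullet> (a *\<^sub>R z) = a * a" by simp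
  have a: "a \<ge> 1" by (simp add: a_def)
  then have a1: "a * a \<ge> 1" by (metis mult_mono' mult_1 zero_le_one)
  have "ln (a * a) / 2 = 2 * pi * real n" using a by (simp add: ln_mult a_def)
  moreover have "cos (2 * pi * real n) = 1" "sin (2 * pi * real n) = 0"
    using cos_2npi[of n] sin_2npi[of n] by (simp_all add: mult_ac)
  ultimately have "sig (a * a) = 1 / a" "zet (a * a) = 0"
    using a a1 by (simp_all add: sig_def zet_def glue_def mult.assoc)
  moreover have "equator_emb (a *\<^sub>R z) = a *\<^sub>R equator_emb z"
    using bounded_linear_equator_emb bounded_linear.linear linear_cmul by blast
  ultimately show ?thesis using a unfolding a_def[symmetric] wrap_def q by simp
qed

lemma immersed_disk_wrap:
  "immersed_disk Nball (cball 0 1) equator (\<lambda>z. wrap (exp (2 * pi * real n) *\<^sub>R z))"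
proof -
  define a where "a = exp (2 * pi * real n)"
  have d: "((\<lambda>z. wrap (a *\<^sub>R z)) has_derivative (\<lambda>v. wrap' (a *\<^sub>R z) (a *\<^sub>R v))) (at z)" for z
    by (rule has_derivative_compose[OF _ wrap_has_derivative]) (auto intro!: derivative_eq_intros)
  have inj: "inj (frechet_derivative (\<lambda>z. wrap (a *\<^sub>R z)) (at z))" for z
    unfolding frechet_derivative_at[OF d, symmetric]
  proof (rule injI)
    fix x y assume "wrap' (a *\<^sub>R z) (a *\<^sub>R x) = wrap' (a *\<^sub>R z) (a *\<^sub>R y)"
    then have "a *\<^sub>R x = a *\<^sub>R y" by (rule injD[OF inj_wrap'])
    then show "x = y" by (simp add: a_def)
  qed
  have C: "Ck_on 2 (\<lambda>z. wrap (a *\<^sub>R z)) (ball 0 1)"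
    by (rule Ck_on_wrap[OF open_ball])
  have cont: "continuous_on S (\<lambda>z. wrap (a *\<^sub>R z))" for S
    using d by (meson has_derivative_at_withinI has_derivative_continuous_on)
  have c: "wrap (a *\<^sub>R z) = equator_emb z" if "norm z = 1" for z
    using wrap_circle[OF that] by (simp add: a_def)
  have "embedding_map circle (top_of_set UNIV) (\<lambda>z. wrap (a *\<^sub>R z))"
    using c by (intro embedding_map_circle cont) (auto simp: inj_on_def inj_eq[OF inj_equator_emb])
  moreover have "(\<lambda>z. wrap (a *\<^sub>R z)) ` sphere 0 1 = equator"
    unfolding equator_def using c by (intro image_cong) auto
  ultimately show ?thesis
    unfolding immersed_disk_def a_def[symmetric] using cont C inj norm_wrap_le
    by (auto simp: o_def)
qed

section \<open>The flux of a volume primitive through the torus\<close>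

lemma bil_expand3: "bil M v w = (\<Sum>i\<in>UNIV. \<Sum>j\<in>UNIV. M$i$j * v$i * w$j)" for M :: "real^3^3"
  by (simp add: bil_def inner_vec_def matrix_vector_mult_def sum_distrib_left mult_ac)

lemma DERIV_bil:
  fixes M :: "real \<Rightarrow> real^3^3"
  assumes "(M has_vector_derivative M') (at s)" "(v has_vector_derivative v') (at s)"
    "(w has_vector_derivative w') (at s)"
  shows "((\<lambda>s. bil (M s) (v s) (w s)) has_real_derivative
     bil M' (v s) (w s) + bil (M s) v' (w s) + bil (M s) (v s) w') (at s)"
proof -
  have v: "((\<lambda>s. v s $ i) has_real_derivative v' $ i) (at s)"
    and w: "((\<lambda>s. w s $ i) has_real_derivative w' $ i) (at s)"
    and M: "((\<lambda>s. M s $ i $ j) has_real_derivative M' $ i $ j) (at s)" for i j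
    using assms bounded_linear.has_vector_derivative[OF bounded_linear_vec_nth]
      bounded_linear.has_vector_derivative[OF bounded_linear_compose[OF bounded_linear_vec_nth bounded_linear_vec_nth]]
    by (auto simp: has_real_derivative_iff_has_vector_derivative)
  have "((\<lambda>s. bil (M s) (v s) (w s)) has_real_derivative
     (\<Sum>i\<in>UNIV. \<Sum>j\<in>UNIV. (M' $ i $ j * v s $ i + v' $ i * M s $ i $ j) * w s $ j + w' $ j * (M s $ i $ j * v s $ i))) (at s)"
    unfolding bil_expand3 by (intro DERIV_sum DERIV_mult v w M)
  moreover have "(\<Sum>i\<in>UNIV. \<Sum>j\<in>UNIV. (M' $ i $ j * v s $ i + v' $ i * M s $ i $ j) * w s $ j + w' $ j * (M s $ i $ j * v s $ i))
    = bil M' (v s) (w s) + bil (M s) v' (w s) + bil (M s) (v s) w'"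
    unfolding bil_expand3 sum.distrib[symmetric] by (intro sum.cong refl) (simp add: algebra_simps)
  ultimately show ?thesis by simp
qed

lemma continuous_on_bil [continuous_intros]:
  fixes M :: "'a::topological_space \<Rightarrow> real^3^3"
  assumes "continuous_on S M" "continuous_on S v" "continuous_on S w"
  shows "continuous_on S (\<lambda>x. bil (M x) (v x) (w x))"
  unfolding bil_expand3 by (intro continuous_intros assms)

lemma bil_antisym:
  fixes M :: "real^3^3"
  assumes "transpose M = - M"
  shows "bil M v w = - bil M w v"
proof -
  have *: "M $ j $ i = - M $ i $ j" for i j
  proof -
    have "M $ j $ i = transpose M $ i $ j" by (simp add: transpose_def)
    also have "\<dots> = - M $ i $ j" by (simp add: assms)
    finally show ?thesis .
  qed
  have "M$1$1 = 0" "M$2$2 = 0" "M$3$3 = 0" "M$2$1 = - M$1$2" "M$3$1 = - M$1$3" "M$3$2 = - M$2$3"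
    using *[of 1 1] *[of 2 2] *[of 3 3] *[of 2 1] *[of 3 1] *[of 3 2] by simp_all
  then show ?thesis
    unfolding bil_expand3 sum_3 by (simp add: algebra_simps)
qed

text \<open>The suffixes \<open>r\<close>, \<open>t\<close>, \<open>p\<close> denote partial derivatives of the toroidal coordinates.\<close>

definition torus :: "real \<Rightarrow> real \<Rightarrow> real \<Rightarrow> real^3" where
  "torus r t p = vector [(2/3 + r * cos t) * cos p, (2/3 + r * cos t) * sin p, r * sin t]"
definition torus_r :: "real \<Rightarrow> real \<Rightarrow> real^3" where
  "torus_r t p = vector [cos t * cos p, cos t * sin p, sin t]"
definition torus_t :: "real \<Rightarrow> real \<Rightarrow> real \<Rightarrow> real^3" where
  "torus_t r t p = vector [- r * sin t * cos p, - r * sin t * sin p, r * cos t]"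
definition torus_p :: "real \<Rightarrow> real \<Rightarrow> real \<Rightarrow> real^3" where
  "torus_p r t p = vector [- (2/3 + r * cos t) * sin p, (2/3 + r * cos t) * cos p, 0]"
definition torus_rt :: "real \<Rightarrow> real \<Rightarrow> real^3" where
  "torus_rt t p = vector [- sin t * cos p, - sin t * sin p, cos t]"
definition torus_rp :: "real \<Rightarrow> real \<Rightarrow> real^3" where
  "torus_rp t p = vector [- cos t * sin p, cos t * cos p, 0]"
definition torus_tp :: "real \<Rightarrow> real \<Rightarrow> real \<Rightarrow> real^3" where
  "torus_tp r t p = vector [r * sin t * sin p, - r * sin t * cos p, 0]"

lemma vector3_eq: "(vector [a, b, c] :: real^3) = a *\<^sub>R axis 1 1 + b *\<^sub>R axis 2 1 + c *\<^sub>R axis 3 1"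
  by (simp add: vec_eq_iff forall_3 axis_def)

lemmas torus_defs = torus_def torus_r_def torus_t_def torus_p_def torus_rt_def torus_rp_def torus_tp_def

lemma has_vector_derivative_vector3:
  assumes "(a has_real_derivative a') (at s)" "(b has_real_derivative b') (at s)" "(c has_real_derivative c') (at s)"
  shows "((\<lambda>s. vector [a s, b s, c s] :: real^3) has_vector_derivative vector [a', b', c']) (at s)"
  unfolding vector3_eq
  by (intro has_vector_derivative_add has_vector_derivative_scaleR[where g'=0, simplified] assms) auto

lemma torus_derivs:
  "((\<lambda>r. torus r t p) has_vector_derivative torus_r t p) (at r)"
  "((\<lambda>t. torus r t p) has_vector_derivative torus_t r t p) (at t)"
  "((\<lambda>p. torus r t p) has_vector_derivative torus_p r t p) (at p)"
  "((\<lambda>r. torus_t r t p) has_vector_derivative torus_rt t p) (at r)"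
  "((\<lambda>r. torus_p r t p) has_vector_derivative torus_rp t p) (at r)"
  "((\<lambda>t. torus_r t p) has_vector_derivative torus_rt t p) (at t)"
  "((\<lambda>t. torus_p r t p) has_vector_derivative torus_tp r t p) (at t)"
  "((\<lambda>p. torus_r t p) has_vector_derivative torus_rp t p) (at p)"
  "((\<lambda>p. torus_t r t p) has_vector_derivative torus_tp r t p) (at p)"
  unfolding torus_defs
  by ((rule has_vector_derivative_vector3; auto intro!: derivative_eq_intros simp: algebra_simps)+)

lemma continuous_on_torus [continuous_intros]:
  fixes f g h :: "'a::t2_space \<Rightarrow> real"
  assumes "continuous_on S f" "continuous_on S g" "continuous_on S h"
  shows "continuous_on S (\<lambda>x. torus (f x) (g x) (h x))" "continuous_on S (\<lambda>x. torus_t (f x) (g x) (h x))"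
    "continuous_on S (\<lambda>x. torus_p (f x) (g x) (h x))" "continuous_on S (\<lambda>x. torus_tp (f x) (g x) (h x))"
  unfolding torus_defs vector3_eq by (intro continuous_intros assms)+

lemma continuous_on_torus_r [continuous_intros]:
  fixes g h :: "'a::t2_space \<Rightarrow> real"
  assumes "continuous_on S g" "continuous_on S h"
  shows "continuous_on S (\<lambda>x. torus_r (g x) (h x))" "continuous_on S (\<lambda>x. torus_rt (g x) (h x))"
    "continuous_on S (\<lambda>x. torus_rp (g x) (h x))"
  unfolding torus_defs vector3_eq by (intro continuous_intros assms)+

lemma torus_inner: "torus r t p \<bullet> torus r t p = (2/3 + r * cos t)^2 + (r * sin t)^2"
proof -
  have "torus r t p \<bullet> torus r t p = (2/3 + r * cos t)^2 * ((sin p)^2 + (cos p)^2) + (r * sin t)^2"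
    unfolding torus_def by (simp add: inner_vec_def sum_3 power2_eq_square algebra_simps
        del: sin_cos_squared_add sin_cos_squared_add2 sin_cos_squared_add3)
  then show ?thesis by simp
qed

lemma torus_inner_le:
  assumes "r \<ge> 0" shows "torus r t p \<bullet> torus r t p \<le> (2/3 + r)^2"
proof -
  have "(2/3 + r * cos t)^2 + (r * sin t)^2 = 4/9 + 4/3 * (r * cos t) + r^2 * ((sin t)^2 + (cos t)^2)"
    by (simp add: power2_eq_square algebra_simps
        del: sin_cos_squared_add sin_cos_squared_add2 sin_cos_squared_add3)
  moreover have "r * cos t \<le> r" using assms by (simp add: mult_left_le)
  ultimately show ?thesis unfolding torus_inner by (simp add: power2_eq_square algebra_simps)
qed

lemma torus_in_ball:
  assumes "0 \<le> r" "r \<le> 1/3" shows "torus r t p \<in> cball 0 1"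
proof -
  have "torus r t p \<bullet> torus r t p \<le> (2/3 + r)^2" using assms by (intro torus_inner_le)
  also have "\<dots> \<le> 1" using assms by (simp add: power_le_one)
  finally show ?thesis by (simp add: dot_square_norm power_le_one_iff abs_square_le_1)
qed

section \<open>Derivatives of periodic functions integrate to zero\<close>

lemma integral_periodic_derivative_fst:
  fixes f f' :: "real \<Rightarrow> real \<Rightarrow> real"
  assumes d: "\<And>t p. ((\<lambda>t. f t p) has_real_derivative f' t p) (at t)"
    and c: "continuous_on UNIV (\<lambda>(t, p). f' t p)" and per: "\<And>p. f b p = f a p" and "a \<le> b"
  shows "integral (cbox (a, c) (b, d)) (\<lambda>(t, p). f' t p) = 0"
proof -
  have "integral (cbox (a, c) (b, d)) (\<lambda>(t, p). f' t p) = integral (cbox (c, a) (d, b)) (\<lambda>(p, t). f' t p)"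
    by (rule integral_swap_2dim) (rule continuous_on_subset[OF c], simp)
  also have "\<dots> = integral (cbox c d) (\<lambda>p. integral (cbox a b) (\<lambda>t. f' t p))"
  proof -
    have "continuous_on UNIV (\<lambda>x. (\<lambda>(t, p). f' t p) (snd x, fst x))"
      by (rule continuous_on_compose2[OF c]) (auto intro!: continuous_intros)
    then have "continuous_on (cbox (c, a) (d, b)) (\<lambda>(p, t). f' t p)"
      by (auto simp: case_prod_unfold intro: continuous_on_subset)
    from integral_prod_continuous[OF this] show ?thesis by simp
  qed
  also have "\<dots> = integral (cbox c d) (\<lambda>p. 0)"
  proof (rule integral_cong)
    fix p
    have "((\<lambda>t. f' t p) has_integral (f b p - f a p)) {a..b}"
      using \<open>a \<le> b\<close> d by (intro fundamental_theorem_of_calculus)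
        (auto simp: has_real_derivative_iff_has_vector_derivative[symmetric] intro: has_field_derivative_at_within)
    then show "integral (cbox a b) (\<lambda>t. f' t p) = 0" using per by (simp add: integral_unique)
  qed
  finally show ?thesis by simp
qed

lemma integral_periodic_derivative_snd:
  fixes f f' :: "real \<Rightarrow> real \<Rightarrow> real"
  assumes d: "\<And>t p. ((\<lambda>p. f t p) has_real_derivative f' t p) (at p)"
    and c: "continuous_on UNIV (\<lambda>(t, p). f' t p)" and per: "\<And>t. f t d = f t c" and "c \<le> d"
  shows "integral (cbox (a, c) (b, d)) (\<lambda>(t, p). f' t p) = 0"
proof -
  have "integral (cbox (a, c) (b, d)) (\<lambda>(t, p). f' t p) = integral (cbox (c, a) (d, b)) (\<lambda>(p, t). f' t p)"
    by (rule integral_swap_2dim) (rule continuous_on_subset[OF c], simp)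
  also have "\<dots> = 0"
  proof (rule integral_periodic_derivative_fst[where f="\<lambda>p t. f t p"])
    have "continuous_on UNIV (\<lambda>x. (\<lambda>(t, p). f' t p) (snd x, fst x))"
      by (rule continuous_on_compose2[OF c]) (auto intro!: continuous_intros)
    then show "continuous_on UNIV (\<lambda>(p, t). f' t p)" by (simp add: case_prod_unfold)
  qed (use assms in auto)
  finally show ?thesis .
qed

text \<open>The primitive stays arbitrary. Its differential is prescribed only on the closed ball,
  so the flux is estimated through tori that lie there.\<close>

locale volume_form =
  fixes A :: "real^3 \<Rightarrow> real^3^3"
  assumes smooth: "smooth_on A UNIV" and antisym: "\<And>x. transpose (A x) = - A x"
    and divergence: "\<And>x. x \<in> cball 0 1 \<Longrightarrow>
      partial 1 A x $ 2 $ 3 + partial 2 A x $ 3 $ 1 + partial 3 A x $ 1 $ 2 = conf x ^ 3"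
begin

definition dA :: "real^3 \<Rightarrow> real^3 \<Rightarrow> real^3^3" where
  "dA x h = frechet_derivative A (at x) h"

lemma Ck_on_A: "Ck_on (Suc 0) A UNIV"
  using smooth by (simp add: smooth_on_def del: Ck_on.simps)

lemma A_has_derivative: "(A has_derivative dA x) (at x)"
  using Ck_on_Suc_has_derivative[OF open_UNIV Ck_on_A] by (simp add: dA_def[abs_def])

lemma dA_expand: "dA x h = h$1 *\<^sub>R partial 1 A x + h$2 *\<^sub>R partial 2 A x + h$3 *\<^sub>R partial 3 A x"
proof -
  have lin: "linear (dA x)" using A_has_derivative has_derivative_linear by blast
  have "h = h$1 *\<^sub>R axis 1 1 + h$2 *\<^sub>R axis 2 1 + h$3 *\<^sub>R axis 3 1"
    by (simp add: vec_eq_iff forall_3 axis_def)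
  then have "dA x h = dA x (h$1 *\<^sub>R axis 1 1 + h$2 *\<^sub>R axis 2 1 + h$3 *\<^sub>R axis 3 1)" by simp
  then show ?thesis by (simp add: linear_add[OF lin] linear_cmul[OF lin] partial_def dA_def[symmetric])
qed

lemma continuous_A: "continuous_on UNIV A"
  using Ck_on_A by (simp add: differentiable_imp_continuous_on)

lemma continuous_on_A [continuous_intros]: "continuous_on S X \<Longrightarrow> continuous_on S (\<lambda>s. A (X s))"
  by (rule continuous_on_compose2[OF continuous_A]) auto

lemma continuous_on_dA [continuous_intros]:
  assumes "continuous_on S X" "continuous_on S h" shows "continuous_on S (\<lambda>s. dA (X s) (h s))"
proof -
  have "continuous_on UNIV (\<lambda>x. partial i A x)" for i
    using Ck_on_A by (simp add: partial_def)
  then have "continuous_on S (\<lambda>s. partial i A (X s))" for i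
    using assms(1) by (rule continuous_on_compose2) auto
  then show ?thesis unfolding dA_expand by (intro continuous_intros assms)
qed

lemma A_chain:
  assumes "(X has_vector_derivative X') (at s)"
  shows "((\<lambda>s. A (X s)) has_vector_derivative dA (X s) X') (at s)"
proof -
  have lin: "linear (dA (X s))" using A_has_derivative has_derivative_linear by blast
  show ?thesis
    using has_derivative_compose[OF assms[unfolded has_vector_derivative_def] A_has_derivative]
    by (simp add: has_vector_derivative_def linear_cmul[OF lin])
qed

text \<open>The cyclic sum is the exterior derivative applied to \<open>a\<close>, \<open>b\<close>,
  \<open>c\<close>; a 3-form in three dimensions is its coefficient times the determinant, here the
  last factor.\<close>

lemma exterior_derivative:
  "bil (dA x a) b c + bil (dA x b) c a + bil (dA x c) a b =
    (partial 1 A x $ 2 $ 3 + partial 2 A x $ 3 $ 1 + partial 3 A x $ 1 $ 2) *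
    (a$1 * (b$2 * c$3 - b$3 * c$2) + a$2 * (b$3 * c$1 - b$1 * c$3) + a$3 * (b$1 * c$2 - b$2 * c$1))"
proof -
  \<comment> \<open>Antisymmetry of the coefficients passes to their partial derivatives by
    uniqueness of the derivative.\<close>
  have "partial i A x $ k $ j = - partial i A x $ j $ k" for i j k
  proof -
    have 1: "((\<lambda>y. A y $ j $ k) has_derivative (\<lambda>h. dA x h $ j $ k)) (at x)" for j k
      using bounded_linear.has_derivative[OF bounded_linear_compose[OF bounded_linear_vec_nth bounded_linear_vec_nth] A_has_derivative] .
    have "A y $ k $ j = - A y $ j $ k" for y
    proof -
      have "A y $ k $ j = transpose (A y) $ j $ k" by (simp add: transpose_def)
      then show ?thesis by (simp add: antisym)
    qed
    then have "((\<lambda>y. A y $ k $ j) has_derivative (\<lambda>h. - dA x h $ j $ k)) (at x)"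
      using has_derivative_minus[OF 1[of j k]] by presburger
    then have "(\<lambda>h. dA x h $ k $ j) = (\<lambda>h. - dA x h $ j $ k)"
      using 1[of k j] has_derivative_unique by blast
    then have "dA x (axis i 1) $ k $ j = - dA x (axis i 1) $ j $ k" by meson
    then show ?thesis by (simp add: partial_def dA_def)
  qed note * = this
  have **: "partial i A x $ 1 $ 1 = 0" "partial i A x $ 2 $ 2 = 0" "partial i A x $ 3 $ 3 = 0"
    "partial i A x $ 2 $ 1 = - partial i A x $ 1 $ 2" "partial i A x $ 1 $ 3 = - partial i A x $ 3 $ 1"
    "partial i A x $ 3 $ 2 = - partial i A x $ 2 $ 3" for i
    using *[of i 1 1] *[of i 2 2] *[of i 3 3] *[of i 2 1] *[of i 1 3] *[of i 3 2] by simp_all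
  show ?thesis
    unfolding bil_expand3 sum_3 dA_expand by (simp add: ** algebra_simps)
qed

definition flux_density :: "real \<Rightarrow> real \<Rightarrow> real \<Rightarrow> real" where
  "flux_density r t p = bil (A (torus r t p)) (torus_t r t p) (torus_p r t p)"

text \<open>The derivatives of the three components of the pulled back 2-form; their sum is its exterior
  derivative.\<close>

definition flux_r' :: "real \<Rightarrow> real \<Rightarrow> real \<Rightarrow> real" where
  "flux_r' r t p = bil (dA (torus r t p) (torus_r t p)) (torus_t r t p) (torus_p r t p)
     + bil (A (torus r t p)) (torus_rt t p) (torus_p r t p) + bil (A (torus r t p)) (torus_t r t p) (torus_rp t p)"
definition flux_t' :: "real \<Rightarrow> real \<Rightarrow> real \<Rightarrow> real" where
  "flux_t' r t p = bil (dA (torus r t p) (torus_t r t p)) (torus_p r t p) (torus_r t p)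
     + bil (A (torus r t p)) (torus_tp r t p) (torus_r t p) + bil (A (torus r t p)) (torus_p r t p) (torus_rt t p)"
definition flux_p' :: "real \<Rightarrow> real \<Rightarrow> real \<Rightarrow> real" where
  "flux_p' r t p = bil (dA (torus r t p) (torus_p r t p)) (torus_r t p) (torus_t r t p)
     + bil (A (torus r t p)) (torus_rp t p) (torus_t r t p) + bil (A (torus r t p)) (torus_r t p) (torus_tp r t p)"

lemma flux_derivs:
  "((\<lambda>r. flux_density r t p) has_real_derivative flux_r' r t p) (at r)"
  "((\<lambda>t. bil (A (torus r t p)) (torus_p r t p) (torus_r t p)) has_real_derivative flux_t' r t p) (at t)"
  "((\<lambda>p. bil (A (torus r t p)) (torus_r t p) (torus_t r t p)) has_real_derivative flux_p' r t p) (at p)"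
  unfolding flux_density_def flux_r'_def flux_t'_def flux_p'_def
  by (intro DERIV_bil A_chain torus_derivs)+

text \<open>Pullback commutes with the exterior derivative: every mixed second derivative of
  \<open>torus\<close> occurs in two of the three terms, in opposite slots, and cancels by
  antisymmetry. The minus sign arises because \<open>torus_r\<close>, \<open>torus_t\<close>,
  \<open>torus_p\<close> is a negatively oriented frame; it is what makes each turn lower the
  functional.\<close>

lemma flux_divergence:
  assumes "0 \<le> r" "r \<le> 1/3"
  shows "flux_r' r t p + flux_t' r t p + flux_p' r t p = - (conf (torus r t p) ^ 3 * (r * (2/3 + r * cos t)))"
proof -
  let ?x = "torus r t p" and ?a = "torus_r t p" and ?b = "torus_t r t p" and ?c = "torus_p r t p"
  have anti: "bil (A ?x) v w = - bil (A ?x) w v" for v w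
    by (rule bil_antisym) (rule antisym)
  have "flux_r' r t p + flux_t' r t p + flux_p' r t p
      = bil (dA ?x ?a) ?b ?c + bil (dA ?x ?b) ?c ?a + bil (dA ?x ?c) ?a ?b"
    unfolding flux_r'_def flux_t'_def flux_p'_def
    using anti[of "torus_rt t p" ?c] anti[of ?b "torus_rp t p"] anti[of "torus_tp r t p" ?a] by simp
  also have "\<dots> = conf ?x ^ 3 *
    (?a$1 * (?b$2 * ?c$3 - ?b$3 * ?c$2) + ?a$2 * (?b$3 * ?c$1 - ?b$1 * ?c$3) + ?a$3 * (?b$1 * ?c$2 - ?b$2 * ?c$1))"
    unfolding exterior_derivative by (simp only: divergence[OF torus_in_ball[OF assms]])
  also have "?a$1 * (?b$2 * ?c$3 - ?b$3 * ?c$2) + ?a$2 * (?b$3 * ?c$1 - ?b$1 * ?c$3) + ?a$3 * (?b$1 * ?c$2 - ?b$2 * ?c$1)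
      = - (r * (2/3 + r * cos t)) * (((sin t)^2 + (cos t)^2) * ((sin p)^2 + (cos p)^2))"
    unfolding torus_defs vector_3 by algebra
  finally show ?thesis by simp
qed

definition flux :: "real \<Rightarrow> real" where
  "flux r = integral (cbox (0, 0) (2*pi, 2*pi)) (\<lambda>(t, p). flux_density r t p)"

lemma continuous_flux:
  "continuous_on S (\<lambda>(t, p). flux_density r t p)" "continuous_on S (\<lambda>(t, p). flux_r' r t p)"
  "continuous_on S (\<lambda>(t, p). flux_t' r t p)" "continuous_on S (\<lambda>(t, p). flux_p' r t p)"
  unfolding case_prod_unfold flux_density_def flux_r'_def flux_t'_def flux_p'_def
  by (intro continuous_intros)+

lemma flux_has_derivative:
  "(flux has_real_derivative integral (cbox (0, 0) (2*pi, 2*pi)) (\<lambda>(t, p). flux_r' r t p)) (at r)"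
proof -
  have "((\<lambda>r. integral (cbox (0, 0) (2*pi, 2*pi)) (\<lambda>x. flux_density r (fst x) (snd x))) has_real_derivative
      integral (cbox (0, 0) (2*pi, 2*pi)) (\<lambda>x. flux_r' r (fst x) (snd x))) (at r within UNIV)"
  proof (rule leibniz_rule_field_derivative)
    show "((\<lambda>r. flux_density r (fst x) (snd x)) has_real_derivative flux_r' r (fst x) (snd x)) (at r)" for r x
      by (rule flux_derivs)
    show "(\<lambda>x. flux_density r (fst x) (snd x)) integrable_on cbox (0, 0) (2*pi, 2*pi)" for r
      using continuous_flux(1) by (intro integrable_continuous) (simp add: case_prod_unfold)
    show "continuous_on (UNIV \<times> cbox (0, 0) (2*pi, 2*pi)) (\<lambda>(r, x). flux_r' r (fst x) (snd x))"
      unfolding case_prod_unfold flux_r'_def by (intro continuous_intros)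
  qed auto
  then show ?thesis by (simp add: flux_def[abs_def] case_prod_unfold)
qed

text \<open>Stokes' theorem in infinitesimal form, for the shell between neighbouring tori: the two
  angular terms vanish by periodicity, which leaves the Riemannian volume density in toroidal
  coordinates.\<close>

lemma flux_derivative_eq:
  assumes "0 \<le> r" "r \<le> 1/3"
  shows "integral (cbox (0, 0) (2*pi, 2*pi)) (\<lambda>(t, p). flux_r' r t p)
    = - integral (cbox (0, 0) (2*pi, 2*pi)) (\<lambda>(t, p). conf (torus r t p) ^ 3 * (r * (2/3 + r * cos t)))"
    (is "?I flux_r' = _")
proof -
  have int: "(\<lambda>(t, p). flux_r' r t p) integrable_on cbox (0, 0) (2*pi, 2*pi)"
    "(\<lambda>(t, p). flux_t' r t p) integrable_on cbox (0, 0) (2*pi, 2*pi)"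
    "(\<lambda>(t, p). flux_p' r t p) integrable_on cbox (0, 0) (2*pi, 2*pi)"
    by (intro integrable_continuous continuous_flux)+
  have t: "integral (cbox (0, 0) (2*pi, 2*pi)) (\<lambda>(t, p). flux_t' r t p) = 0"
    by (rule integral_periodic_derivative_fst[OF flux_derivs(2) continuous_flux(3)]) (simp_all add: torus_defs)
  have p: "integral (cbox (0, 0) (2*pi, 2*pi)) (\<lambda>(t, p). flux_p' r t p) = 0"
    by (rule integral_periodic_derivative_snd[OF flux_derivs(3) continuous_flux(4)]) (simp_all add: torus_defs)
  have "- integral (cbox (0, 0) (2*pi, 2*pi)) (\<lambda>(t, p). conf (torus r t p) ^ 3 * (r * (2/3 + r * cos t)))
     = integral (cbox (0, 0) (2*pi, 2*pi)) (\<lambda>x. (case x of (t, p) \<Rightarrow> flux_r' r t p)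
         + (case x of (t, p) \<Rightarrow> flux_t' r t p) + (case x of (t, p) \<Rightarrow> flux_p' r t p))"
    unfolding integral_neg[symmetric] using flux_divergence[OF assms]
    by (intro integral_cong) (auto simp: case_prod_unfold)
  also have "\<dots> = integral (cbox (0, 0) (2*pi, 2*pi)) (\<lambda>(t, p). flux_r' r t p)"
    using int t p by (simp add: integral_add integrable_add)
  finally show ?thesis by simp
qed

text \<open>\<open>K\<close> serves two regimes: a definite rate in the tube of radius 1/6, whose
  points have norm at most 5/6 and see a large metric, and the rate 0 in the rest, where
  \<open>conf\<close> is only known to be positive.\<close>

lemma flux_derivative_le:
  fixes r K :: real
  assumes "0 \<le> r" "r \<le> 1/3" "K \<ge> 0" and K: "K > 0 \<Longrightarrow> r \<le> 1/6" and KL: "K \<le> 10^18 / 5184"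
  shows "integral (cbox (0, 0) (2*pi, 2*pi)) (\<lambda>(t, p). flux_r' r t p) \<le> - (4 * pi^2 * K * r)"
proof -
  let ?B = "cbox (0, 0) (2*pi, 2*pi) :: (real \<times> real) set"
  have "4 * pi^2 * K * r = integral ?B (\<lambda>x. K * r)"
    by (subst integral_const) (simp add: content_Pair power2_eq_square)
  also have "\<dots> \<le> integral ?B (\<lambda>(t, p). conf (torus r t p) ^ 3 * (r * (2/3 + r * cos t)))"
  proof (rule integral_le)
    show "(\<lambda>(t, p). conf (torus r t p) ^ 3 * (r * (2/3 + r * cos t))) integrable_on ?B"
      unfolding case_prod_unfold conf_def by (intro integrable_continuous continuous_intros)
    fix x
    obtain t p :: real where x: "x = (t, p)" by fastforce
    have "\<bar>r * cos t\<bar> \<le> 1/3 * 1"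
      unfolding abs_mult using assms by (intro mult_mono) auto
    then have c: "1/3 \<le> 2/3 + r * cos t" by linarith
    have "K * r \<le> conf (torus r t p) ^ 3 * (r * (1/3))"
    proof (cases "K > 0")
      case True
      have "torus r t p \<bullet> torus r t p \<le> (2/3 + r)^2" using assms by (intro torus_inner_le) 
      also have "\<dots> \<le> (5/6)^2" using K[OF True] assms by (intro power_mono) auto
      finally have "11/36 \<le> 1 - torus r t p \<bullet> torus r t p" by (simp add: power2_eq_square)
      then have "(11/36)^2 \<le> (1 - torus r t p \<bullet> torus r t p)^2" by (intro power_mono) auto
      \<comment> \<open>(11/36)^2 = 121/1296 exceeds 1/12, and the cube of 1/12 is 3/5184; the 3
        absorbs the lower bound 1/3 of the distance to the axis.\<close>
      then have "10^6/12 \<le> conf (torus r t p)" by (simp add: conf_def power2_eq_square)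
      then have "(10^6/12)^3 \<le> conf (torus r t p) ^ 3" by (intro power_mono) auto
      then have "3 * K \<le> conf (torus r t p) ^ 3" using KL by (simp add: power3_eq_cube)
      then have "3 * K * (r * (1/3)) \<le> conf (torus r t p) ^ 3 * (r * (1/3))" using assms by (intro mult_right_mono) auto
      then show ?thesis by simp
    next
      case False
      then have "K = 0" using \<open>K \<ge> 0\<close> by simp
      then show ?thesis using assms conf_pos[of "torus r t p"] by simp
    qed
    also have "\<dots> \<le> conf (torus r t p) ^ 3 * (r * (2/3 + r * cos t))"
      using assms c conf_pos[of "torus r t p"] by (intro mult_left_mono) auto
    finally show "K * r \<le> (case x of (t, p) \<Rightarrow> conf (torus r t p) ^ 3 * (r * (2/3 + r * cos t)))"
      by (simp add: x)
  qed auto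
  finally show ?thesis unfolding flux_derivative_eq[OF assms(1,2)] by simp
qed

text \<open>Integrating the rate \<open>?K * r\<close> up to 1/6 gives \<open>?K / 72\<close>, and
  5184 * 72 = 373248; from 1/6 to 1/3 monotonicity is enough.\<close>

lemma flux_le: "flux (1/3) \<le> - (4 * pi^2 * (10^18 / 373248))"
proof -
  let ?K = "10^18 / 5184 :: real"
  \<comment> \<open>At radius 0 the torus collapses to its core circle.\<close>
  have "flux 0 = 0"
    by (simp add: flux_def flux_density_def torus_t_def bil_def inner_vec_def matrix_vector_mult_def sum_3 case_prod_unfold)
  have "flux (1/6) + 4 * pi^2 * ?K * ((1/6)^2 / 2) \<le> flux 0 + 4 * pi^2 * ?K * (0^2 / 2)"
  proof (rule DERIV_nonpos_imp_nonincreasing[where f="\<lambda>r. flux r + 4 * pi^2 * ?K * (r^2 / 2)"])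
    fix r :: real assume r: "0 \<le> r" "r \<le> 1/6"
    have "((\<lambda>r. flux r + 4 * pi^2 * ?K * (r^2 / 2)) has_real_derivative
      integral (cbox (0, 0) (2*pi, 2*pi)) (\<lambda>(t, p). flux_r' r t p) + 4 * pi^2 * ?K * r) (at r)"
      by (rule derivative_eq_intros flux_has_derivative refl | simp)+
    moreover have "integral (cbox (0, 0) (2*pi, 2*pi)) (\<lambda>(t, p). flux_r' r t p) \<le> - (4 * pi^2 * ?K * r)"
      by (rule flux_derivative_le) (use r in auto)
    ultimately show "\<exists>y. ((\<lambda>r. flux r + 4 * pi^2 * ?K * (r^2 / 2)) has_real_derivative y) (at r) \<and> y \<le> 0"
      by (intro exI conjI) auto
  qed simp
  moreover have "flux (1/3) \<le> flux (1/6)"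
  proof (rule DERIV_nonpos_imp_nonincreasing[where f=flux])
    fix r :: real assume "1/6 \<le> r" "r \<le> 1/3"
    then have "integral (cbox (0, 0) (2*pi, 2*pi)) (\<lambda>(t, p). flux_r' r t p) \<le> - (4 * pi^2 * 0 * r)"
      by (intro flux_derivative_le) auto
    then show "\<exists>y. (flux has_real_derivative y) (at r) \<and> y \<le> 0"
      using flux_has_derivative by auto
  qed simp
  ultimately show ?thesis using \<open>flux 0 = 0\<close> by (simp add: power2_eq_square)
qed

end

section \<open>Polar coordinates\<close>

lemma vector2_cbox:
  "(vector [x, y] :: real^2) \<in> cbox (vector [a, c]) (vector [b, d]) \<longleftrightarrow> (x, y) \<in> cbox (a, c) (b, d)"
  by (auto simp: mem_box_cart forall_2 cbox_Pair_eq)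

text \<open>Disks are parametrized over \<open>real^2\<close>, whereas the flux is an integral over
  pairs; the identification preserves boxes and their areas.\<close>

lemma integral_vec2:
  fixes f :: "real \<times> real \<Rightarrow> real"
  assumes "f integrable_on cbox (a, c) (b, d)"
  shows "integral (cbox (vector [a, c]) (vector [b, d])) (\<lambda>x::real^2. f (x$1, x$2)) = integral (cbox (a, c) (b, d)) f"
proof -
  let ?g = "\<lambda>x::real^2. (x$1, x$2)" and ?h = "\<lambda>x::real \<times> real. (vector [fst x, snd x] :: real^2)"
  have hg: "?h (?g x) = x" for x by (simp add: vec_eq_iff forall_2)
  have gh: "?g (?h x) = x" for x by simp
  have h: "?h ` cbox (l, m) (u, v) = cbox (vector [l, m]) (vector [u, v])" for l m u v
  proof (intro equalityI subsetI)
    fix x assume "x \<in> cbox (vector [l, m]) (vector [u, v] :: real^2)"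
    then have "?g x \<in> cbox (l, m) (u, v)" by (auto simp: mem_box_cart forall_2 cbox_Pair_eq)
    then show "x \<in> ?h ` cbox (l, m) (u, v)" by (rule image_eqI[of x ?h "?g x", OF hg[symmetric]])
  qed (auto simp: vector2_cbox)
  have g: "?g ` cbox u v = cbox (u$1, u$2) (v$1, v$2)" for u v :: "real^2"
  proof (intro equalityI subsetI)
    fix y assume "y \<in> cbox (u$1, u$2) (v$1, v$2)"
    then have "?h y \<in> cbox u v" by (auto simp: mem_box_cart forall_2 cbox_Pair_eq mem_Times_iff)
    then show "y \<in> ?g ` cbox u v" by (rule image_eqI[of y ?g "?h y", OF gh[symmetric]])
  qed (auto simp: mem_box_cart forall_2 cbox_Pair_eq)
  have "((\<lambda>x. f (?g x)) has_integral (1 / 1) *\<^sub>R integral (cbox (a, c) (b, d)) f) (?h ` cbox (a, c) (b, d))"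
  proof (rule has_integral_twiddle[where g="?g" and h="?h"])
    show "continuous (at x) ?g" for x
      by (intro continuous_intros)
    show "\<exists>w z. ?g ` cbox u v = cbox w z" for u v using g[of u v] by blast
    show "\<exists>w z. ?h ` cbox u v = cbox w z" for u v
      using h[of "fst u" "snd u" "fst v" "snd v"] unfolding prod.collapse by blast
    show "measure lborel (?g ` cbox u v) = 1 * measure lborel (cbox u v)" for u v :: "real^2"
    proof (cases "cbox u v = {}")
      case False
      then have "u$1 \<le> v$1" "u$2 \<le> v$2" by (auto simp: interval_ne_empty_cart forall_2)
      then show ?thesis unfolding g using False by (simp add: content_Pair content_cbox_cart UNIV_2)
    qed auto
  qed (use hg gh assms in \<open>auto intro: integrable_integral\<close>)
  then show ?thesis unfolding h by (simp add: integral_unique)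
qed

section \<open>Change of variables for scalar integrands\<close>

lemma absolutely_integrable_continuous_bounded:
  fixes f :: "'a::euclidean_space \<Rightarrow> real"
  assumes "continuous_on UNIV f" "bounded S" "S \<in> sets lebesgue"
  shows "f absolutely_integrable_on S"
proof -
  obtain a where "S \<subseteq> cbox (-a) a" using bounded_subset_cbox_symmetric[OF \<open>bounded S\<close>] by blast
  moreover have "f absolutely_integrable_on cbox (-a) a"
    by (rule absolutely_integrable_continuous) (rule continuous_on_subset[OF assms(1)], simp)
  ultimately show ?thesis using assms(3) set_integrable_subset by blast
qed

text \<open>The scalar integrand is embedded in \<open>real^1\<close>, where the formula for
  vector-valued functions applies, and projected back.\<close>

lemma integral_change_of_variables_real:
  fixes f :: "real^'m::{finite,wellorder} \<Rightarrow> real" and g :: "real^'m::_ \<Rightarrow> real^'m::_"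
  assumes S: "S \<in> sets lebesgue"
    and der_g: "\<And>x. x \<in> S \<Longrightarrow> (g has_derivative g' x) (at x within S)"
    and inj: "inj_on g S"
    and int: "(\<lambda>x. \<bar>det (matrix (g' x))\<bar> * f (g x)) absolutely_integrable_on S"
  shows "f absolutely_integrable_on (g ` S)"
    and "integral (g ` S) f = integral S (\<lambda>x. \<bar>det (matrix (g' x))\<bar> * f (g x))"
proof -
  let ?v = "\<lambda>y. vec y :: real^1" and ?D = "\<lambda>x. \<bar>det (matrix (g' x))\<bar> * f (g x)"
  have v: "bounded_linear ?v"
    by (simp add: linear_conv_bounded_linear[symmetric] linear_vec)
  have c: "bounded_linear (\<lambda>y::real^1. y $ 1)" by (rule bounded_linear_vec_nth)
  have "(\<lambda>x. \<bar>det (matrix (g' x))\<bar> *\<^sub>R ?v (f (g x))) = ?v \<circ> ?D"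
    by (simp add: fun_eq_iff vec_eq_iff)
  then have "(\<lambda>x. \<bar>det (matrix (g' x))\<bar> *\<^sub>R ?v (f (g x))) absolutely_integrable_on S \<and>
      integral S (\<lambda>x. \<bar>det (matrix (g' x))\<bar> *\<^sub>R ?v (f (g x))) = ?v (integral S ?D)"
    using absolutely_integrable_linear[OF int v] integral_linear[OF _ v, of ?D S] int
    by (auto simp: absolutely_integrable_on_def)
  then have *: "(\<lambda>x. ?v (f x)) absolutely_integrable_on (g ` S) \<and> integral (g ` S) (\<lambda>x. ?v (f x)) = ?v (integral S ?D)"
    using has_absolute_integral_change_of_variables[OF S der_g inj, of "\<lambda>x. ?v (f x)"] by blast
  then show ai: "f absolutely_integrable_on (g ` S)"
    using absolutely_integrable_linear[OF conjunct1[OF *] c] by (simp add: o_def)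
  have "integral (g ` S) (?v \<circ> f) = ?v (integral (g ` S) f)"
    by (rule integral_linear[OF _ v]) (use ai in \<open>simp add: absolutely_integrable_on_def\<close>)
  then have "?v (integral (g ` S) f) = ?v (integral S ?D)"
    using * by (simp add: o_def)
  then show "integral (g ` S) f = integral S ?D" by (simp add: vec_eq_iff)
qed

lemma integral_ball_scale:
  fixes f :: "real^2 \<Rightarrow> real"
  assumes "continuous_on UNIV f" "a > 0"
  shows "integral (ball 0 a) f = integral (ball 0 1) (\<lambda>z. a^2 * f (a *\<^sub>R z))"
proof -
  have det: "det (matrix (\<lambda>v::real^2. a *\<^sub>R v)) = a^2"
    by (simp add: det_2 matrix_def axis_def power2_eq_square)
  have im: "(\<lambda>z. a *\<^sub>R z) ` ball 0 1 = ball (0::real^2) a"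
    using \<open>a > 0\<close> by (simp add: ball_scale)
  have cont: "continuous_on UNIV (\<lambda>z. \<bar>det (matrix (\<lambda>v::real^2. a *\<^sub>R v))\<bar> * f (a *\<^sub>R z))"
    by (intro continuous_intros continuous_on_compose2[OF assms(1)]) auto
  have "integral ((\<lambda>z. a *\<^sub>R z) ` ball 0 1) f
      = integral (ball 0 1) (\<lambda>z. \<bar>det (matrix (\<lambda>v::real^2. a *\<^sub>R v))\<bar> * f (a *\<^sub>R z))"
  proof (rule integral_change_of_variables_real)
    show "((\<lambda>z. a *\<^sub>R z) has_derivative (\<lambda>v. a *\<^sub>R v)) (at x within ball 0 1)" for x :: "real^2"
      by (auto intro!: derivative_eq_intros)
    show "(\<lambda>z. \<bar>det (matrix (\<lambda>v::real^2. a *\<^sub>R v))\<bar> * f (a *\<^sub>R z)) absolutely_integrable_on ball 0 1"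
      by (rule absolutely_integrable_continuous_bounded[OF cont]) auto
  qed (use \<open>a > 0\<close> in \<open>auto simp: inj_on_def\<close>)
  then show ?thesis unfolding im det by simp
qed

text \<open>The complex exponential of x1 + c + i x2, conformal with Jacobian
  \<open>exp (2 * (x$1 + c))\<close>; the shift \<open>c\<close> selects the annulus.\<close>

definition polar :: "real \<Rightarrow> real^2 \<Rightarrow> real^2" where
  "polar c x = exp (x$1 + c) *\<^sub>R vector [cos (x$2), sin (x$2)]"

lemma polar_nth [simp]: "polar c x $ 1 = exp (x$1 + c) * cos (x$2)" "polar c x $ 2 = exp (x$1 + c) * sin (x$2)"
  by (simp_all add: polar_def)

lemma norm_polar: "norm (polar c x) = exp (x$1 + c)"
proof -
  have "norm (vector [cos (x$2), sin (x$2)] :: real^2) = 1"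
    by (simp add: norm_eq_1 inner_vec_def sum_2 power2_eq_square[symmetric])
  then show ?thesis by (simp add: polar_def)
qed

lemma polar_has_derivative:
  "(polar c has_derivative (\<lambda>v. v$1 *\<^sub>R polar c x + v$2 *\<^sub>R (exp (x$1 + c) *\<^sub>R vector [- sin (x$2), cos (x$2)]))) (at x within S)"
proof -
  have v: "(vector [a, b] :: real^2) = a *\<^sub>R axis 1 1 + b *\<^sub>R axis 2 1" for a b
    by (simp add: vec_eq_iff forall_2 axis_def)
  note d = bounded_linear_imp_has_derivative[OF bounded_linear_vec_nth]
  show ?thesis
    unfolding polar_def[abs_def] v
    by (rule derivative_eq_intros d refl)+ (simp add: fun_eq_iff algebra_simps)
qed

lemma det_polar:
  "det (matrix (\<lambda>v. v$1 *\<^sub>R polar c x + v$2 *\<^sub>R (exp (x$1 + c) *\<^sub>R vector [- sin (x$2), cos (x$2)]))) = exp (2 * (x$1 + c))"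
proof -
  have "det (matrix (\<lambda>v. v$1 *\<^sub>R polar c x + v$2 *\<^sub>R (exp (x$1 + c) *\<^sub>R vector [- sin (x$2), cos (x$2)])))
      = exp (x$1 + c) * exp (x$1 + c) * ((sin (x$2))^2 + (cos (x$2))^2)"
    by (simp add: det_2 matrix_def axis_def power2_eq_square algebra_simps
      del: sin_cos_squared_add sin_cos_squared_add2 sin_cos_squared_add3)
  then show ?thesis by (simp add: exp_add[symmetric])
qed

text \<open>Open, so that angles are unique and \<open>polar\<close> is injective; what the image
  misses of the annulus is negligible.\<close>

definition polar_box :: "(real^2) set" where
  "polar_box = box (vector [0, 0]) (vector [2 * pi, 2 * pi])"

lemma mem_polar_box: "x \<in> polar_box \<longleftrightarrow> 0 < x$1 \<and> x$1 < 2 * pi \<and> 0 < x$2 \<and> x$2 < 2 * pi"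
  by (auto simp: polar_box_def mem_box_cart forall_2)

lemma inj_on_polar: "inj_on (polar c) polar_box"
proof (rule inj_onI)
  fix x y assume x: "x \<in> polar_box" and y: "y \<in> polar_box" and eq: "polar c x = polar c y"
  have 1: "x$1 = y$1" using arg_cong[OF eq, of norm] by (simp add: norm_polar)
  have "cos (x$2) = cos (y$2)" "sin (x$2) = sin (y$2)"
    using arg_cong[OF eq, of "\<lambda>w. w$1"] arg_cong[OF eq, of "\<lambda>w. w$2"] 1 by auto
  then obtain n :: int where n: "x$2 = y$2 + 2 * pi * n"
    using sin_cos_eq_iff[of "x$2" "y$2"] by blast
  have "(2 * pi) * real_of_int n < (2 * pi) * 1" "(2 * pi) * -1 < (2 * pi) * real_of_int n"
    using x y n unfolding mem_polar_box by linarith+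
  then have "real_of_int n < 1" "-1 < real_of_int n"
    using mult_less_cancel_left_pos[of "2 * pi"] pi_gt_zero by (metis mult_pos_pos zero_less_numeral)+
  then have "n = 0" by linarith
  then have "x$2 = y$2" using n by simp
  with 1 show "x = y" by (simp add: vec_eq_iff forall_2)
qed

lemma polar_image:
  "polar c ` polar_box \<subseteq> {w. exp c < norm w \<and> norm w < exp (c + 2 * pi)}"
  "{w. exp c < norm w \<and> norm w < exp (c + 2 * pi) \<and> w$2 \<noteq> 0} \<subseteq> polar c ` polar_box"
proof -
  show "polar c ` polar_box \<subseteq> {w. exp c < norm w \<and> norm w < exp (c + 2 * pi)}"
    by (auto simp: norm_polar mem_polar_box)
  show "{w. exp c < norm w \<and> norm w < exp (c + 2 * pi) \<and> w$2 \<noteq> 0} \<subseteq> polar c ` polar_box"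
  proof safe
    fix w :: "real^2" assume w: "exp c < norm w" "norm w < exp (c + 2 * pi)" "w$2 \<noteq> 0"
    have pos: "norm w > 0" using w(1) exp_gt_zero[of c] by linarith
    have "(w$1 / norm w)^2 + (w$2 / norm w)^2 = (w \<bullet> w) / (norm w)^2"
      by (simp add: inner_vec_def sum_2 power_divide add_divide_distrib power2_eq_square)
    also have "\<dots> = 1" using pos by (simp add: dot_square_norm)
    finally obtain p where p: "0 \<le> p" "p < 2 * pi" "w$1 / norm w = cos p" "w$2 / norm w = sin p"
      using sincos_total_2pi by metis
    have "p \<noteq> 0" using p(4) w(3) pos by auto
    define x where "x = (vector [ln (norm w) - c, p] :: real^2)"
    have "ln (exp c) < ln (norm w)" "ln (norm w) < ln (exp (c + 2 * pi))"
      using w pos by (subst ln_less_cancel_iff; simp)+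
    then have "x \<in> polar_box" using p \<open>p \<noteq> 0\<close> by (simp add: mem_polar_box x_def)
    moreover have "w = polar c x"
    proof -
      have "norm w * cos p = w$1" "norm w * sin p = w$2"
        unfolding p(3,4)[symmetric] using pos by simp_all
      moreover have "exp (x$1 + c) = norm w" "x$2 = p" using pos by (simp_all add: x_def)
      ultimately show ?thesis by (simp only: vec_eq_iff forall_2 polar_nth simp_thms)
    qed
    ultimately show "w \<in> polar c ` polar_box" by blast
  qed
qed

lemma integral_annulus_polar:
  fixes f :: "real^2 \<Rightarrow> real"
  assumes f: "continuous_on UNIV f"
  shows "integral (ball 0 (exp (c + 2 * pi))) f =
    integral (ball 0 (exp c)) f + integral polar_box (\<lambda>x. exp (2 * (x$1 + c)) * f (polar c x))"
proof -
  have cont: "continuous_on UNIV (\<lambda>x. exp (2 * (x$1 + c)) * f (polar c x))"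
    by (intro continuous_intros continuous_on_compose2[OF f] has_derivative_continuous_on[OF polar_has_derivative]) auto
  have ai: "(\<lambda>x. exp (2 * (x$1 + c)) * f (polar c x)) absolutely_integrable_on polar_box"
    by (rule absolutely_integrable_continuous_bounded[OF cont]) (auto simp: polar_box_def)
  have "polar_box \<in> sets lebesgue" by (simp add: polar_box_def)
  note cov = integral_change_of_variables_real[OF this polar_has_derivative inj_on_polar, of c f,
    unfolded det_polar abs_exp_cancel, OF ai]
  have sub: "exp c < exp (c + 2 * pi)" by simp
  have "integral (ball 0 (exp (c + 2 * pi))) f = integral (ball 0 (exp c) \<union> polar c ` polar_box) f"
  proof (rule integral_spike_set)
    \<comment> \<open>Only the inner circle and a ray are missed; discarding the whole line through
      the ray is harmless.\<close>
    have neg: "negligible (sphere 0 (exp c) \<union> {w::real^2. w$2 = 0})"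
      by (intro negligible_Un negligible_sphere negligible_standard_hyperplane_cart)
    show "negligible {x \<in> ball 0 (exp (c + 2 * pi)) - (ball 0 (exp c) \<union> polar c ` polar_box). f x \<noteq> 0}"
      by (rule negligible_subset[OF neg]) (use polar_image(2)[of c] in force)
    have "ball 0 (exp c) \<union> polar c ` polar_box \<subseteq> ball 0 (exp (c + 2 * pi))"
    proof (rule Un_least)
      show "ball 0 (exp c) \<subseteq> ball (0::real^2) (exp (c + 2 * pi))" using sub by (intro subset_ball) simp
      show "polar c ` polar_box \<subseteq> ball 0 (exp (c + 2 * pi))" using polar_image(1)[of c] by auto
    qed
    then have "{x \<in> ball 0 (exp c) \<union> polar c ` polar_box - ball 0 (exp (c + 2 * pi)). f x \<noteq> 0} = {}"
      by blast
    then show "negligible {x \<in> ball 0 (exp c) \<union> polar c ` polar_box - ball 0 (exp (c + 2 * pi)). f x \<noteq> 0}"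
      by (simp only: negligible_empty)
  qed
  also have "\<dots> = integral (ball 0 (exp c)) f + integral (polar c ` polar_box) f"
  proof (rule integral_Un)
    have "f absolutely_integrable_on ball 0 (exp c)"
      by (rule absolutely_integrable_continuous_bounded[OF f]) auto
    then show "f integrable_on ball 0 (exp c)" by (simp add: absolutely_integrable_on_def)
    show "f integrable_on polar c ` polar_box" using cov(1) by (simp add: absolutely_integrable_on_def)
    have "ball 0 (exp c) \<inter> polar c ` polar_box = {}" using polar_image(1)[of c] by force
    then show "negligible (ball 0 (exp c) \<inter> polar c ` polar_box)" by simp
  qed
  finally show ?thesis unfolding cov(2) .
qed

section \<open>The functional on the wrapping disks\<close>

lemma chart_at_Nball: "chart_at Nball p = ball_chart"
  unfolding chart_at_def by (rule some_equality) auto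

lemma continuous_on_wrap: "continuous_on S wrap"
  by (rule has_derivative_continuous_on[OF has_derivative_at_withinI[OF wrap_has_derivative]])

lemma continuous_on_wrap': "continuous_on S (\<lambda>w. wrap' w v)"
proof -
  have c: "continuous_on S (\<lambda>w::real^2. g (w \<bullet> w))"
    if "\<And>y. (g has_real_derivative g' y) (at y)" for g g' :: "real \<Rightarrow> real"
    by (rule continuous_on_compose2[of UNIV g])
      (use that in \<open>auto intro!: continuous_intros DERIV_isCont simp: continuous_on_eq_continuous_at\<close>)
  show ?thesis
    unfolding wrap'_def
    by (intro continuous_intros c[OF sig_deriv] c[OF sig1_deriv] c[OF zet1_deriv]
        linear_continuous_on[OF bounded_linear_equator_emb])
qed

lemma continuous_on_conf: "continuous_on S f \<Longrightarrow> continuous_on S (\<lambda>x. conf (f x))"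
  unfolding conf_def by (intro continuous_intros)

text \<open>For \<open>t \<ge> 0\<close> the outer formulas of the profile apply, the angle is ln
  |w|, and the \<open>n\<close> full turns disappear from sine and cosine. As \<open>w\<close> and
  its quarter turn are the derivatives of \<open>w\<close> in \<open>t\<close> and \<open>p\<close>,
  the two combinations of partial derivatives are the coordinate vectors of the torus.\<close>

lemma wrap_polar:
  assumes "t \<ge> 0" and w: "w = exp (t + 2 * pi * real n) *\<^sub>R vector [cos p, sin p]"
  shows "wrap w = torus (1/3) t p"
    and "w$1 *\<^sub>R wrap' w (axis 1 1) + w$2 *\<^sub>R wrap' w (axis 2 1) = torus_t (1/3) t p"
    and "- w$2 *\<^sub>R wrap' w (axis 1 1) + w$1 *\<^sub>R wrap' w (axis 2 1) = torus_p (1/3) t p"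
proof -
  define s where "s = t + 2 * pi * real n"
  define a where "a = exp s"
  have s: "s \<ge> 0" using assms by (simp add: s_def)
  have a: "a \<ge> 1" "a > 0" using s by (simp_all add: a_def)
  have w': "w = vector [a * cos p, a * sin p]"
    by (simp add: w a_def s_def vec_eq_iff forall_2)
  have ww: "w \<bullet> w = a^2"
  proof -
    have "w \<bullet> w = a^2 * ((sin p)^2 + (cos p)^2)"
      unfolding w' by (simp add: inner_vec_def sum_2 power2_eq_square algebra_simps
        del: sin_cos_squared_add sin_cos_squared_add2 sin_cos_squared_add3)
    then show ?thesis by simp
  qed
  have a1: "a^2 \<ge> 1" using a by (simp add: one_le_power)
  have "ln (a^2) / 2 = s" using a by (simp add: ln_realpow a_def)
  moreover have "cos s = cos t" "sin s = sin t"
    using cos_2npi[of n] sin_2npi[of n] by (simp_all add: s_def cos_add sin_add mult_ac)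
  ultimately have sig: "sig (a^2) = (2/3 + cos t / 3) / a" "sig1 (a^2) = (- sin t / 3 - 2/3 - cos t / 3) / (2 * a^2 * a)"
    and zet: "zet (a^2) = sin t / 3" "zet1 (a^2) = cos t / (6 * a^2)"
    using a a1 by (simp_all add: sig_def sig1_def zet_def zet1_def glue_def)
  show "wrap w = torus (1/3) t p"
    using a unfolding wrap_def ww sig zet by (simp add: w' torus_def vec_eq_iff forall_3 axis_def)
  have t: "wrap' w v = (2 * (w \<bullet> v) * sig1 (a^2)) *\<^sub>R equator_emb w + sig (a^2) *\<^sub>R equator_emb v
     + (2 * (w \<bullet> v) * zet1 (a^2)) *\<^sub>R axis 3 1" for v
    by (simp add: wrap'_def ww)
  have "w$1 *\<^sub>R wrap' w (axis 1 1) + w$2 *\<^sub>R wrap' w (axis 2 1) = wrap' w (w$1 *\<^sub>R axis 1 1 + w$2 *\<^sub>R axis 2 1)"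
    by (simp add: linear_add[OF linear_wrap'] linear_cmul[OF linear_wrap'])
  also have "w$1 *\<^sub>R axis 1 1 + w$2 *\<^sub>R axis 2 1 = w"
    by (simp add: vec_eq_iff forall_2 axis_def)
  also have "wrap' w w = torus_t (1/3) t p"
    using a unfolding t ww sig zet
    by (simp add: w' torus_t_def vec_eq_iff forall_3 axis_def power2_eq_square field_simps)
  finally show "w$1 *\<^sub>R wrap' w (axis 1 1) + w$2 *\<^sub>R wrap' w (axis 2 1) = torus_t (1/3) t p" .
  have "- w$2 *\<^sub>R wrap' w (axis 1 1) + w$1 *\<^sub>R wrap' w (axis 2 1) = wrap' w ((- w$2) *\<^sub>R axis 1 1 + w$1 *\<^sub>R axis 2 1)"
    by (simp add: linear_add[OF linear_wrap'] linear_cmul[OF linear_wrap'] linear_diff[OF linear_wrap'] linear_neg[OF linear_wrap'])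
  also have "(- w$2) *\<^sub>R axis 1 1 + w$1 *\<^sub>R axis 2 1 = (vector [- w$2, w$1] :: real^2)"
    by (simp add: vec_eq_iff forall_2 axis_def)
  also have "wrap' w (vector [- w$2, w$1]) = torus_p (1/3) t p"
  proof -
    have "w \<bullet> vector [- w$2, w$1] = 0" by (simp add: inner_vec_def sum_2)
    then show ?thesis
      using a unfolding t sig zet
      by (simp add: w' torus_p_def vec_eq_iff forall_3 axis_def field_simps)
  qed
  finally show "- w$2 *\<^sub>R wrap' w (axis 1 1) + w$1 *\<^sub>R wrap' w (axis 2 1) = torus_p (1/3) t p" .
qed

text \<open>An alternating form scales with the determinant of the change of frame, here that of a
  rotation times a dilation.\<close>

lemma bil_rotation:
  fixes M :: "real^3^3"
  assumes "transpose M = - M"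
  shows "bil M (x *\<^sub>R P + y *\<^sub>R Q) (- y *\<^sub>R P + x *\<^sub>R Q) = (x^2 + y^2) * bil M P Q"
proof -
  have z: "bil M v v = 0" for v using bil_antisym[OF assms, of v v] by simp
  have "bil M (x *\<^sub>R P + y *\<^sub>R Q) (- y *\<^sub>R P + x *\<^sub>R Q)
      = - (x * y) * bil M P P + x^2 * bil M P Q - y^2 * bil M Q P + x * y * bil M Q Q"
    by (simp add: bil_def matrix_vector_right_distrib matrix_vector_mult_diff_distrib matrix_vector_mult_scaleR
        inner_simps power2_eq_square algebra_simps)
  then show ?thesis using z bil_antisym[OF assms, of Q P] by (simp add: algebra_simps)
qed

context volume_form
begin

definition energy :: "real^2 \<Rightarrow> real" where
  "energy w = (conf (wrap w))^2 * (wrap' w (axis 1 1) \<bullet> wrap' w (axis 1 1) + wrap' w (axis 2 1) \<bullet> wrap' w (axis 2 1))"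

definition pull :: "real^2 \<Rightarrow> real" where
  "pull w = bil (A (wrap w)) (wrap' w (axis 1 1)) (wrap' w (axis 2 1))"

lemma continuous_energy: "continuous_on S energy"
  unfolding energy_def[abs_def] by (intro continuous_intros continuous_on_conf continuous_on_wrap continuous_on_wrap')

lemma continuous_pull: "continuous_on S pull"
  unfolding pull_def[abs_def] by (intro continuous_intros continuous_on_wrap continuous_on_wrap')

lemma energy_nonneg: "energy w \<ge> 0"
  by (simp add: energy_def)

text \<open>Conformal invariance: the factor |w|^2 is both the Jacobian of \<open>polar\<close> and
  the rescaling of the two densities between the frames, so \<open>n\<close> drops out on the right.
  The weight \<open>h\<close> will be \<open>4 * H\<close>.\<close>

lemma energy_polar:
  assumes "t \<ge> 0" and w: "w = exp (t + 2 * pi * real n) *\<^sub>R vector [cos p, sin p]"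
  shows "exp (2 * (t + 2 * pi * real n)) * (energy w + h * pull w) =
    (conf (torus (1/3) t p))^2 * (1/9 + (2/3 + cos t / 3)^2) + h * flux_density (1/3) t p"
proof -
  let ?P = "wrap' w (axis 1 1)" and ?Q = "wrap' w (axis 2 1)"
  note W = wrap_polar[OF assms]
  have ww: "exp (2 * (t + 2 * pi * real n)) = (w$1)^2 + (w$2)^2"
  proof -
    have "(w$1)^2 + (w$2)^2 = (exp (t + 2 * pi * real n))^2 * ((sin p)^2 + (cos p)^2)"
      unfolding w by (simp add: power_mult_distrib algebra_simps
        del: sin_cos_squared_add sin_cos_squared_add2 sin_cos_squared_add3)
    then show ?thesis by (simp only: exp_double sin_cos_squared_add mult_1_right)
  qed
  have "((w$1)^2 + (w$2)^2) * (?P \<bullet> ?P + ?Q \<bullet> ?Q)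
      = torus_t (1/3) t p \<bullet> torus_t (1/3) t p + torus_p (1/3) t p \<bullet> torus_p (1/3) t p"
    unfolding W(2,3)[symmetric] by (simp add: inner_simps inner_commute power2_eq_square algebra_simps)
  also have "\<dots> = 1/9 * (((sin t)^2 * ((sin p)^2 + (cos p)^2)) + (cos t)^2) + (2/3 + cos t / 3)^2 * ((sin p)^2 + (cos p)^2)"
    by (simp add: torus_t_def torus_p_def inner_vec_def sum_3 power2_eq_square algebra_simps add_divide_distrib
        del: sin_cos_squared_add sin_cos_squared_add2 sin_cos_squared_add3)
  also have "\<dots> = 1/9 + (2/3 + cos t / 3)^2" by simp
  finally have 1: "((w$1)^2 + (w$2)^2) * (?P \<bullet> ?P + ?Q \<bullet> ?Q) = 1/9 + (2/3 + cos t / 3)^2" .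
  have 2: "((w$1)^2 + (w$2)^2) * pull w = flux_density (1/3) t p"
    unfolding pull_def flux_density_def W(1) W(2,3)[symmetric] by (rule bil_rotation[OF antisym, symmetric])
  show ?thesis
    unfolding ww unfolding 1[symmetric] 2[symmetric] energy_def W(1) by (simp add: algebra_simps)
qed

definition period :: "real \<Rightarrow> real" where
  "period h = integral polar_box (\<lambda>x. (conf (torus (1/3) (x$1) (x$2)))^2 * (1/9 + (2/3 + cos (x$1) / 3)^2)
     + h * flux_density (1/3) (x$1) (x$2))"

text \<open>The unit ball carries the cap; every further annulus is one turn.\<close>

lemma integral_ball_energy:
  "integral (ball 0 (exp (2 * pi * real n))) (\<lambda>w. energy w + h * pull w)
    = integral (ball 0 1) (\<lambda>w. energy w + h * pull w) + real n * period h"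
proof (induction n)
  case (Suc n)
  have c: "continuous_on UNIV (\<lambda>w. energy w + h * pull w)"
    by (intro continuous_intros continuous_energy continuous_pull)
  have "integral polar_box (\<lambda>x. exp (2 * (x$1 + 2 * pi * real n)) * (energy (polar (2 * pi * real n) x) + h * pull (polar (2 * pi * real n) x)))
      = period h"
    unfolding period_def
    by (intro integral_cong energy_polar) (auto simp: mem_polar_box polar_def)
  moreover have "2 * pi * real (Suc n) = 2 * pi * real n + 2 * pi" by (simp add: algebra_simps)
  ultimately show ?case
    using integral_annulus_polar[OF c, of "2 * pi * real n"] Suc by (simp add: algebra_simps)
qed simp

text \<open>The torus has |torus_t|^2 = 1/9 and |torus_p|^2 \<le> 1, whence 10/9. Up to the common
  factor 4 pi^2, the energy is at most about 1.1 * 10^12, while already \<open>h = 4\<close> yields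
  a flux term below -1.07 * 10^13.\<close>

lemma period_neg:
  assumes "h > 4"
  shows "period h < 0"
proof -
  let ?B = "cbox (0, 0) (2*pi, 2*pi) :: (real \<times> real) set"
  let ?e = "\<lambda>(t, p). (conf (torus (1/3) t p))^2 * (1/9 + (2/3 + cos t / 3)^2)"
  have e: "?e integrable_on ?B"
    unfolding case_prod_unfold by (intro integrable_continuous continuous_intros continuous_on_conf) auto
  have f: "(\<lambda>(t, p). flux_density (1/3) t p) integrable_on ?B"
    by (intro integrable_continuous continuous_flux)
  have hf: "(\<lambda>x. h * (case x of (t, p) \<Rightarrow> flux_density (1/3) t p)) integrable_on ?B"
    using integrable_on_cmult_left[OF f, of h] by simp
  have "period h = integral (cbox (vector [0, 0]) (vector [2 * pi, 2 * pi]))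
      (\<lambda>x::real^2. (\<lambda>x. ?e x + h * (case x of (t, p) \<Rightarrow> flux_density (1/3) t p)) (x$1, x$2))"
    by (simp add: period_def polar_box_def integral_open_interval)
  also have "\<dots> = integral ?B (\<lambda>x. ?e x + h * (case x of (t, p) \<Rightarrow> flux_density (1/3) t p))"
    by (rule integral_vec2) (intro integrable_add e hf)
  also have "\<dots> = integral ?B ?e + h * flux (1/3)"
    using integral_add[OF e hf] by (simp add: flux_def)
  finally have 1: "period h = integral ?B ?e + h * flux (1/3)" .
  have "integral ?B ?e \<le> integral ?B (\<lambda>x. (1/2 + 10^6)^2 * (10/9))"
  proof (rule integral_le[OF e])
    fix x :: "real \<times> real"
    obtain t p where x: "x = (t, p)" by fastforce
    have "torus (1/3) t p \<bullet> torus (1/3) t p \<le> 1"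
      using torus_inner_le[of "1/3" t p] by simp
    then have "(1 - torus (1/3) t p \<bullet> torus (1/3) t p)^2 \<le> 1"
      by (intro power_le_one) auto
    then have "conf (torus (1/3) t p) \<le> 1/2 + 10^6" by (simp add: conf_def)
    then have "(conf (torus (1/3) t p))^2 \<le> (1/2 + 10^6)^2"
      using conf_pos[of "torus (1/3) t p"] by (intro power_mono) auto
    moreover have "(2/3 + cos t / 3)^2 \<le> 1"
      using cos_ge_minus_one[of t] cos_le_one[of t] by (intro power_le_one; linarith)
    then have "1/9 + (2/3 + cos t / 3)^2 \<le> 10/9" by simp
    ultimately show "?e x \<le> (1/2 + 10^6)^2 * (10/9)"
      unfolding x prod.case by (intro mult_mono) auto
  qed auto
  also have "integral ?B (\<lambda>x. (1/2 + 10^6)^2 * (10/9::real)) = 4 * pi^2 * ((1/2 + 10^6)^2 * (10/9))"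
    by (subst integral_const) (simp add: content_Pair power2_eq_square)
  finally have 2: "integral ?B ?e \<le> 4 * pi^2 * ((1/2 + 10^6)^2 * (10/9))" .
  have "h * flux (1/3) \<le> h * - (4 * pi^2 * (10^18 / 373248))"
    using assms by (intro mult_left_mono flux_le) auto
  \<comment> \<open>The flux bound is negative, so passing from \<open>h\<close> down to 4 increases
    the product.\<close>
  also have "\<dots> \<le> 4 * - (4 * pi^2 * (10^18 / 373248))"
    using assms by (intro mult_right_mono_neg) auto
  finally have "period h \<le> 4 * pi^2 * ((1/2 + 10^6)^2 * (10/9)) + 4 * - (4 * pi^2 * (10^18 / 373248))"
    unfolding 1 using 2 by linarith
  also have "\<dots> = 4 * pi^2 * ((1/2 + 10^6)^2 * (10/9) - 4 * (10^18 / 373248))"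
    by (simp only: algebra_simps)
  also have "\<dots> < 0"
    by (intro mult_pos_neg) (simp_all add: power2_eq_square)
  finally show ?thesis .
qed

text \<open>Both densities gain \<open>a^2\<close>, the Jacobian of the dilation, so the functional
  becomes an integral of fixed densities over a growing ball. Their continuity on the whole plane
  makes the extended real value finite.\<close>

lemma F_H_wrap:
  assumes om: "om ball_chart = A" and "a > 0"
  shows "F_H Nball om H (\<lambda>z. wrap (a *\<^sub>R z)) = ereal (integral (ball 0 a) (\<lambda>w. energy w + 4 * H * pull w))"
proof -
  have d: "((\<lambda>z. wrap (a *\<^sub>R z)) has_derivative (\<lambda>v. wrap' (a *\<^sub>R z) (a *\<^sub>R v))) (at z)" for z
    by (rule has_derivative_compose[OF _ wrap_has_derivative]) (auto intro!: derivative_eq_intros)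
  have partial: "partial i (\<lambda>z. wrap (a *\<^sub>R z)) z = a *\<^sub>R wrap' (a *\<^sub>R z) (axis i 1)" for i z
    unfolding partialI[OF d] by (simp add: linear_cmul[OF linear_wrap'])
  define E where "E z = a^2 * energy (a *\<^sub>R z)" for z
  define P where "P z = a^2 * pull (a *\<^sub>R z)" for z
  have E: "energy_density Nball (\<lambda>z. wrap (a *\<^sub>R z)) z = E z" for z
    by (simp add: energy_density_def chart_at_Nball Let_def o_def partial ball_metric_def bil_scaleR_mat
        E_def energy_def power2_eq_square algebra_simps)
  have P: "pullback_density Nball om (\<lambda>z. wrap (a *\<^sub>R z)) z = P z" for z
    by (simp add: pullback_density_def chart_at_Nball Let_def o_def partial om P_def pull_def
        power2_eq_square bil_def matrix_vector_mult_scaleR)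
  have cE: "continuous_on UNIV E" and cP: "continuous_on UNIV P"
    unfolding E_def[abs_def] P_def[abs_def]
    by (intro continuous_intros continuous_on_compose2[OF continuous_energy]
        continuous_on_compose2[OF continuous_pull]; auto)+
  have si: "set_integrable lborel (ball 0 1) f" if "continuous_on UNIV f" for f :: "real^2 \<Rightarrow> real"
    by (rule set_integrable_subset[of _ "cball 0 1"])
      (use that borel_integrable_compact[of "cball 0 1" f] in
        \<open>auto simp: set_integrable_def intro: continuous_on_subset\<close>)
  have "(\<integral>\<^sup>+z\<in>ball 0 1. ennreal (E z) \<partial>lborel) = (\<integral>\<^sup>+z. ennreal (indicator (ball 0 1) z *\<^sub>R E z) \<partial>lborel)"
    by (intro nn_integral_cong) (auto simp: indicator_def)
  also have "\<dots> = ennreal (LINT z:ball 0 1|lborel. E z)"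
    unfolding set_lebesgue_integral_def
    by (rule nn_integral_eq_integral)
      (use si[OF cE] energy_nonneg in \<open>auto simp: set_integrable_def E_def\<close>)
  also have "(LINT z:ball 0 1|lborel. E z) = integral (ball 0 1) E"
    by (rule set_borel_integral_eq_integral(2)[OF si[OF cE]])
  finally have e: "(\<integral>\<^sup>+z\<in>ball 0 1. ennreal (E z) \<partial>lborel) = ennreal (integral (ball 0 1) E)" .
  have iE: "E integrable_on ball 0 1" and iP: "P integrable_on ball 0 1"
    using set_borel_integral_eq_integral(1)[OF si] cE cP by auto
  have pos: "integral (ball 0 1) E \<ge> 0"
    by (rule integral_nonneg[OF iE]) (simp add: E_def energy_nonneg)
  have "F_H Nball om H (\<lambda>z. wrap (a *\<^sub>R z)) = ereal (integral (ball 0 1) E + 4 * H * integral (ball 0 1) P)"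
    unfolding F_H_def E P e set_borel_integral_eq_integral(2)[OF si[OF cP]] using pos by simp
  also have "integral (ball 0 1) E + 4 * H * integral (ball 0 1) P = integral (ball 0 1) (\<lambda>z. E z + 4 * H * P z)"
    using integral_add[OF iE integrable_on_cmult_left[OF iP, of "4 * H"]] by simp
  also have "\<dots> = integral (ball 0 a) (\<lambda>w. energy w + 4 * H * pull w)"
    by (subst integral_ball_scale[OF _ \<open>a > 0\<close>])
      (auto intro!: continuous_intros continuous_energy continuous_pull simp: E_def P_def algebra_simps)
  finally show ?thesis .
qed

lemma F_H_unbounded_below:
  assumes "om ball_chart = A" "H > 1"
  obtains v where "immersed_disk Nball (cball 0 1) equator v" "F_H Nball om H v < ereal K"
proof -
  define D where "D = period (4 * H)"
  have "D < 0" unfolding D_def using \<open>H > 1\<close> by (intro period_neg) simp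
  define I where "I = integral (ball 0 1) (\<lambda>w. energy w + 4 * H * pull w)"
  \<comment> \<open>Since \<open>D\<close> is negative, enough turns outweigh the fixed contribution
    \<open>I\<close> of the cap.\<close>
  obtain n :: nat where "(I - K) / (- D) < real n" using reals_Archimedean2 by blast
  then have n: "I + real n * D < K" using \<open>D < 0\<close> by (simp add: field_simps)
  show ?thesis
  proof (rule that[OF immersed_disk_wrap[of n]])
    show "F_H Nball om H (\<lambda>z. wrap (exp (2 * pi * real n) *\<^sub>R z)) < ereal K"
      unfolding F_H_wrap[of om, OF assms(1) exp_gt_zero] integral_ball_energy
      using n by (simp add: I_def D_def)
  qed
qed

end

section \<open>Exclusion of a minimizer\<close>

lemma volume_formI:
  assumes "volume_primitive Nball (cball 0 1) om"
  shows "volume_form (om ball_chart)"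
proof
  show "smooth_on (om ball_chart) UNIV"
    using assms by (simp add: volume_primitive_def smooth_tensor2_Nball)
qed (use assms in \<open>auto simp: volume_primitive_def sqrt_det_ball_metric\<close>)

theorem mainTheorem4:
  shows "\<exists>(N :: (real^3) riem) M \<Gamma>.
    H0_convex 2 N M \<and>
    jordan_curve_in (subtopology (Top N) (bdry N M)) \<Gamma> \<and>
    nullhomotopic_curve_in (subtopology (Top N) M) \<Gamma> \<and>
    (\<exists>\<omega>. volume_primitive N M \<omega>) \<and>
    (\<forall>\<omega>. volume_primitive N M \<omega> \<longrightarrow>
       (\<forall>H\<in>{1<..<2}. \<not> (\<exists>\<Sigma>. minimizing_H_disk N M \<omega> H \<Gamma> \<Sigma>)))"
proof (intro exI conjI allI impI ballI notI)
  show "H0_convex 2 Nball (cball 0 1)" by (rule H0_convex_ball)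
  show "jordan_curve_in (subtopology (Top Nball) (bdry Nball (cball 0 1))) equator" by (rule jordan_equator)
  show "nullhomotopic_curve_in (subtopology (Top Nball) (cball 0 1)) equator" by (rule nullhomotopic_equator)
  show "volume_primitive Nball (cball 0 1) radial_primitive" by (rule volume_primitive_radial_primitive)
next
  fix \<omega> :: "(real^3) tensor2" and H :: real
  assume om: "volume_primitive Nball (cball 0 1) \<omega>" and H: "H \<in> {1<..<2}"
    and "\<exists>\<Sigma>. minimizing_H_disk Nball (cball 0 1) \<omega> H equator \<Sigma>"
  then obtain u where
    min: "\<And>v. immersed_disk Nball (cball 0 1) equator v \<Longrightarrow> F_H Nball \<omega> H u \<le> F_H Nball \<omega> H v"
    unfolding minimizing_H_disk_def by blast
  interpret volume_form "\<omega> ball_chart" using om by (rule volume_formI)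
  \<comment> \<open>\<open>K\<close> is a real number in any case, with the default value 0 of the
    integral if the density is not integrable. The energy of \<open>u\<close> is nonnegative,
    possibly infinite, so \<open>F_H\<close> of \<open>u\<close> is at least \<open>K\<close>, which
    some wrapping disk undercuts.\<close>
  define K where "K = 4 * H * (LINT z:ball 0 1|lborel. pullback_density Nball \<omega> u z)"
  have "H > 1" using H by simp
  then obtain v where v: "immersed_disk Nball (cball 0 1) equator v" "F_H Nball \<omega> H v < ereal K"
    by (rule F_H_unbounded_below[of \<omega> H K, OF refl])
  have "0 + ereal K \<le> F_H Nball \<omega> H u"
    unfolding F_H_def K_def by (rule add_right_mono) (rule enn2ereal_nonneg)
  also have "\<dots> \<le> F_H Nball \<omega> H v" by (rule min[OF v(1)])
  finally show False using v(2) by simp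
qed

end
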